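(* Let $G$ be a finite simple $2$-connected graph. Let $H$ be a simple $2$-connected subgraph of $G$ on $m$ vertices such that $\widehat{\alpha}(I(M(H)))=\frac{m}{2}$. Then $\widehat{\rho}(I(M(G)))\ge 2-\frac{2}{m}$. If $H$ is also a spanning subgraph of $G$, then $\widehat{\rho}(I(M(G)))=2-\frac{2}{|V(G)|}$.
   Context: Graphs are finite; $V(G)$ and $E(G)$ are the vertex and edge sets. A graph is simple if it has no loops or parallel edges; it is $2$-connected if it is connected and remains connected after deletion of any vertex. A subgraph $H$ of $G$ is spanning if $V(H)=V(G)$. The graphic matroid $M(G)$ is the matroid on the ground set $E(G)$ whose independent sets are the edge sets of acyclic subgraphs; its bases are the edge sets of spanning forests. Standing assumption: the matroids $M$ considered satisfy $\mathrm{rk}(M)<|E|$ (i.e. the graphs contain a cycle). Let $\mathbb{K}$ be a field. For a matroid $M$ on a finite ground set $E$, let $S=\mathbb{K}[x_e : e\in E]$ and define the facet ideal $I(M)=\langle \prod_{e\in B}x_e : B \text{ a basis of } M\rangle\subset S$. For a squarefree monomial ideal $I\subset S$, the $s$-th symbolic power is $I^{(s)}=\bigcap_{P\in \mathrm{Min}(I)}P^s$, where $\mathrm{Min}(I)$ is the set of minimal primes of $I$. Let $\alpha(I)$ be the least degree of a nonzero homogeneous element of $I$. The Waldschmidt constant is $\widehat{\alpha}(I)=\lim_{s\to\infty}\alpha(I^{(s)})/s$. The asymptotic resurgence is $\widehat{\rho}(I)=\sup\{s/r : s,r \text{ positive integers},\ I^{(st)}\not\subset I^{rt}\text{ for all }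 t\gg 0\}$. *)

theory Defs
  imports
    Complex_Main
    "HOL-Algebra.Ideal_Product"
    "HOL-Library.Poly_Mapping"
    "HOL-Library.Extended_Real"
begin

section \<open>Finite simple graphs\<close>

text \<open>Edges are two-element sets of vertices, so loops and parallel edges cannot occur.\<close>

record 'v graph =
  verts :: "'v set"
  edges :: "'v set set"

definition simple_graph :: "'v graph \<Rightarrow> bool" where
  "simple_graph G \<longleftrightarrow>
     finite (verts G) \<and> (\<forall>e\<in>edges G. e \<subseteq> verts G \<and> card e = 2)"

definition subgraph :: "'v graph \<Rightarrow> 'v graph \<Rightarrow> bool" where
  "subgraph H G \<longleftrightarrow> verts H \<subseteq> verts G \<and> edges H \<subseteq> edges G"

definition spanning :: "'v graph \<Rightarrow> 'v graph \<Rightarrow> bool" where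
  "spanning H G \<longleftrightarrow> verts H = verts G"

text \<open>The graph without vertices is not connected.\<close>

definition connected_graph :: "'v graph \<Rightarrow> bool" where
  "connected_graph G \<longleftrightarrow>
     verts G \<noteq> {} \<and>
     (\<forall>u\<in>verts G. \<forall>v\<in>verts G. (u, v) \<in> {(x, y). {x, y} \<in> edges G}\<^sup>*)"

definition delete_vertex :: "'v graph \<Rightarrow> 'v \<Rightarrow> 'v graph" where
  "delete_vertex G v =
     \<lparr>verts = verts G - {v}, edges = {e \<in> edges G. v \<notin> e}\<rparr>"

definition two_connected :: "'v graph \<Rightarrow> bool" where
  "two_connected G \<longleftrightarrow>
     connected_graph G \<and> (\<forall>v\<in>verts G. connected_graph (delete_vertex G v))"

text \<open>A cycle is given by its cyclic sequence of at least three distinct vertices.\<close>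

definition is_cycle :: "'v set set \<Rightarrow> 'v list \<Rightarrow> bool" where
  "is_cycle F vs \<longleftrightarrow>
     length vs \<ge> 3 \<and> distinct vs \<and>
     (\<forall>i<length vs. {vs ! i, vs ! (Suc i mod length vs)} \<in> F)"

definition acyclic_edges :: "'v set set \<Rightarrow> bool" where
  "acyclic_edges F \<longleftrightarrow> (\<nexists>vs. is_cycle F vs)"


section \<open>Matroids\<close>

text \<open>
  The record carries only the data of a matroid, its ground set and its independent
  sets; the matroid axioms are not part of the type. The notions below are
  only meant for matroids, such as the graphic matroid of a finite simple graph.
\<close>

record 'e matroid_data =
  ground :: "'e set"
  indep :: "'e set set"

definition bases :: "'e matroid_data \<Rightarrow> 'e set set" where
  "bases M = {B \<in> indep M. \<forall>J\<in>indep M. B \<subseteq> J \<longrightarrow> J = B}"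

definition rank :: "'e matroid_data \<Rightarrow> nat" where
  "rank M = Max (card ` indep M)"

definition graphic_matroid :: "'v graph \<Rightarrow> 'v set matroid_data" where
  "graphic_matroid G =
     \<lparr>ground = edges G, indep = {F. F \<subseteq> edges G \<and> acyclic_edges F}\<rparr>"


section \<open>Polynomials with variables indexed by a finite set\<close>

text \<open>
  A polynomial maps exponent vectors to coefficients. The ring with variables in
  \<open>E\<close> consists of the polynomials all of whose monomials involve only variables in \<open>E\<close>.
\<close>

type_synonym ('e, 'k) mpoly = "('e \<Rightarrow>\<^sub>0 nat) \<Rightarrow>\<^sub>0 'k"

definition mpoly_ring :: "'e set \<Rightarrow> ('e, 'k::field) mpoly ring" where
  "mpoly_ring E =
     \<lparr>carrier = {p. \<forall>m\<in>Poly_Mapping.keys p. Poly_Mapping.keys m \<subseteq> E},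
      monoid.mult = (*), one = 1, ring.zero = 0, add = (+)\<rparr>"

definition mvar :: "'e \<Rightarrow> ('e, 'k::field) mpoly" where
  "mvar e = Poly_Mapping.single (Poly_Mapping.single e 1) 1"

definition monom_degree :: "('e \<Rightarrow>\<^sub>0 nat) \<Rightarrow> nat" where
  "monom_degree m = (\<Sum>e\<in>Poly_Mapping.keys m. Poly_Mapping.lookup m e)"

definition homogeneous :: "nat \<Rightarrow> ('e, 'k::field) mpoly \<Rightarrow> bool" where
  "homogeneous d p \<longleftrightarrow> (\<forall>m\<in>Poly_Mapping.keys p. monom_degree m = d)"

lemma mpoly_ring_cring: "cring (mpoly_ring E :: ('e, 'k::field) mpoly ring)"
proof -
  let ?R = "mpoly_ring E :: ('e, 'k) mpoly ring"
  define C where "C = carrier ?R"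
  have memI: "p \<in> C \<longleftrightarrow> (\<forall>m\<in>Poly_Mapping.keys p. Poly_Mapping.keys m \<subseteq> E)" for p
    by (simp add: C_def mpoly_ring_def)
  have one: "1 \<in> C" and zero: "0 \<in> C"
    by (simp_all add: memI)
  have plus: "p + q \<in> C" if "p \<in> C" "q \<in> C" for p q
    using that Poly_Mapping.keys_add[of p q] unfolding memI by blast
  have neg: "- p \<in> C" if "p \<in> C" for p
    using that by (simp add: memI)
  have times: "p * q \<in> C" if "p \<in> C" "q \<in> C" for p q
    unfolding memI
  proof
    fix m assume "m \<in> Poly_Mapping.keys (p * q)"
    then obtain a b where "m = a + b" "a \<in> Poly_Mapping.keys p" "b \<in> Poly_Mapping.keys q"
      using keys_mult[of p q] by blast
    then show "Poly_Mapping.keys m \<subseteq> E"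
      using that Poly_Mapping.keys_add[of a b] unfolding memI by blast
  qed
  have carr: "carrier ?R = C"
    by (simp add: C_def)
  have ops: "x \<otimes>\<^bsub>?R\<^esub> y = x * y" "x \<oplus>\<^bsub>?R\<^esub> y = x + y"
    "\<one>\<^bsub>?R\<^esub> = 1" "\<zero>\<^bsub>?R\<^esub> = 0" for x y
    by (simp_all add: mpoly_ring_def)
  have "abelian_group ?R"
    by (rule abelian_groupI; unfold carr ops)
      (use zero plus neg in \<open>auto simp: add_ac intro: bexI[of _ "- x" for x]\<close>)
  moreover have "Group.comm_monoid ?R"
    by (rule comm_monoidI; unfold carr ops)
      (use one times in \<open>auto simp: mult_ac\<close>)
  ultimately show ?thesis
    by (rule cringI) (simp add: ops distrib_right)
qed


section \<open>Symbolic powers and their asymptotic invariants\<close>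

definition facet_ideal :: "'e matroid_data \<Rightarrow> ('e, 'k::field) mpoly set" where
  "facet_ideal M = Idl\<^bsub>mpoly_ring (ground M)\<^esub> {\<Prod>e\<in>B. mvar e | B. B \<in> bases M}"

definition minimal_primes :: "('a, 'b) ring_scheme \<Rightarrow> 'a set \<Rightarrow> 'a set set" where
  "minimal_primes R I =
     {P. primeideal P R \<and> I \<subseteq> P \<and>
         (\<forall>Q. primeideal Q R \<and> I \<subseteq> Q \<and> Q \<subseteq> P \<longrightarrow> Q = P)}"

text \<open>Ordinary powers are powers in the multiplicative monoid of ideals; the zeroth is \<open>R\<close>.\<close>

definition ideal_power :: "('a, 'b) ring_scheme \<Rightarrow> 'a set \<Rightarrow> nat \<Rightarrow> 'a set" where
  "ideal_power R I s = I [^]\<^bsub>ideals_set R\<^esub> s"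

text \<open>The intersection is taken inside \<open>R\<close>, so it is \<open>R\<close> if there is no minimal prime.\<close>

definition symbolic_power :: "('a, 'b) ring_scheme \<Rightarrow> 'a set \<Rightarrow> nat \<Rightarrow> 'a set" where
  "symbolic_power R I s = carrier R \<inter> (\<Inter>P\<in>minimal_primes R I. ideal_power R P s)"

definition initial_degree :: "('e, 'k::field) mpoly set \<Rightarrow> nat" where
  "initial_degree I = (LEAST d. \<exists>f\<in>I. f \<noteq> 0 \<and> homogeneous d f)"

text \<open>
  In the next two definitions \<open>E\<close> indexes the variables of the ring containing \<open>I\<close>.
\<close>

definition waldschmidt_constant :: "'e set \<Rightarrow> ('e, 'k::field) mpoly set \<Rightarrow> real" where
  "waldschmidt_constant E I =
     lim (\<lambda>s. real (initial_degree (symbolic_power (mpoly_ring E) I s)) / real s)"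

text \<open>The supremum is taken in the extended reals, where it always exists.\<close>

definition asymptotic_resurgence :: "'e set \<Rightarrow> ('e, 'k::field) mpoly set \<Rightarrow> ereal" where
  "asymptotic_resurgence E I =
     Sup {ereal (real s / real r) | s r. s > 0 \<and> r > 0 \<and>
       (\<forall>\<^sub>F t in sequentially.
          \<not> symbolic_power (mpoly_ring E) I (s * t) \<subseteq> ideal_power (mpoly_ring E) I (r * t))}"

end

theory Submission
  imports Defs
begin

text \<open>
  Every ideal in play is a monomial ideal, so the whole statement is about exponent vectors
  \<open>a\<close>, that is, about nonnegative integer weights on the edges of \<open>G\<close>. The minimal primes of the
  facet ideal are generated by the variables in the minimal sets of edges that meet every
  spanning tree. Hence \<open>x^a\<close> lies in the \<open>s\<close>-th symbolic power iff every edge set that meets all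
  spanning trees, in particular every cut, has weight at least \<open>s\<close>; and \<open>x^a\<close> lies in the \<open>r\<close>-th
  ordinary power iff \<open>a\<close> dominates a sum of \<open>r\<close> spanning trees. Write \<open>n\<close> and \<open>m\<close> for the numbers of
  vertices of \<open>G\<close> and \<open>H\<close>.

  Upper bound. Let every cut have weight at least \<open>k\<close>. Replace each edge \<open>e\<close> by two opposite arcs
  of capacity \<open>a e\<close>. For every root \<open>v\<close>, Edmonds' theorem on disjoint arborescences
  (lemma \<open>arborescence_packing\<close>, with Lovasz' proof) packs \<open>k\<close> spanning trees without using an arc
  into \<open>v\<close>. Over all roots these are \<open>n k\<close> trees, and each of the two arcs of an edge is available
  for only \<open>n - 1\<close> roots, so the trees load an edge \<open>e\<close> with at most \<open>2 (n - 1) a e\<close>. Dividing the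
  multiplicities of the trees by \<open>2 (n - 1)\<close> and rounding down shows that \<open>a\<close> dominates
  \<open>n k / (2 (n - 1)) - O(1)\<close> trees, where the error does not depend on \<open>k\<close>
  (lemma \<open>symbolic_in_ordinary\<close>). Thus the asymptotic resurgence is at most
  \<open>2 (n - 1) / n = 2 - 2 / n\<close>.

  Lower bound. The Waldschmidt constant is the limit of a convergent sequence, by Fekete's lemma.
  So for large \<open>k\<close> there are weights \<open>b\<close> on the edges of \<open>H\<close> of total weight about \<open>k m / 2\<close> whose cuts
  have weight at least \<open>k\<close>. Partition the vertices of \<open>G\<close> into \<open>m\<close> connected blocks with one vertex
  of \<open>H\<close> each. Give weight \<open>k\<close> to the edges inside blocks, and weight \<open>b\<close> to the other edges,
  with \<open>b\<close> extended by zero outside \<open>H\<close>. A cut of \<open>G\<close> either splits a block or restricts to a cut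
  of \<open>H\<close>, so it still has weight at least \<open>k\<close>. On the other hand a spanning tree of \<open>G\<close> has at least
  \<open>m - 1\<close> edges between different blocks, and the total weight there is only about \<open>k m / 2\<close>. So
  these weights dominate at most about \<open>(k m / 2) / (m - 1)\<close> spanning trees
  (lemma \<open>extend_exponent_to_supergraph\<close>), which gives the ratio \<open>2 (m - 1) / m = 2 - 2 / m\<close>.
\<close>

section \<open>Monomial ideals and their powers\<close>

definition exponents :: "'e set \<Rightarrow> ('e \<Rightarrow>\<^sub>0 nat) set" where
  "exponents E = {a. Poly_Mapping.keys a \<subseteq> E}"

definition deg_on :: "'e set \<Rightarrow> ('e \<Rightarrow>\<^sub>0 nat) \<Rightarrow> nat" where
  "deg_on C a = (\<Sum>e\<in>C. Poly_Mapping.lookup a e)"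

text \<open>
  These are the sets of exponents of the monomials in a monomial ideal.
\<close>

definition upset :: "'e set \<Rightarrow> ('e \<Rightarrow>\<^sub>0 nat) set \<Rightarrow> bool" where
  "upset E X \<longleftrightarrow> X \<subseteq> exponents E \<and> (\<forall>a\<in>X. \<forall>b\<in>exponents E. a + b \<in> X)"

definition monomial_ideal :: "('e \<Rightarrow>\<^sub>0 nat) set \<Rightarrow> ('e, 'k::field) mpoly set" where
  "monomial_ideal X = {p. Poly_Mapping.keys p \<subseteq> X}"

definition minkowski_sum :: "'a::plus set \<Rightarrow> 'a set \<Rightarrow> 'a set" where
  "minkowski_sum X Y = {x + y | x y. x \<in> X \<and> y \<in> Y}"

text \<open>
  The empty sum is the set of all exponents because the zeroth power of an ideal is the ring.
\<close>

fun nfold_sum :: "'e set \<Rightarrow> ('e \<Rightarrow>\<^sub>0 nat) set \<Rightarrow> nat \<Rightarrow> ('e \<Rightarrow>\<^sub>0 nat) set" where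
  "nfold_sum E X 0 = exponents E"
| "nfold_sum E X (Suc n) = minkowski_sum (nfold_sum E X n) X"

lemma deg_on_add: "deg_on C (a + b) = deg_on C a + deg_on C b"
  by (simp add: deg_on_def lookup_add sum.distrib)

lemma deg_on_mono: "finite D \<Longrightarrow> C \<subseteq> D \<Longrightarrow> deg_on C a \<le> deg_on D a"
  unfolding deg_on_def by (rule sum_mono2) auto

lemma zero_in_exponents [simp]: "0 \<in> exponents E"
  by (simp add: exponents_def)

lemma add_in_exponents: "a \<in> exponents E \<Longrightarrow> b \<in> exponents E \<Longrightarrow> a + b \<in> exponents E"
  unfolding exponents_def using Poly_Mapping.keys_add[of a b] by auto

lemma carrier_mpoly_ring: "carrier (mpoly_ring E :: ('e, 'k::field) mpoly ring) = monomial_ideal (exponents E)"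
  by (auto simp: mpoly_ring_def monomial_ideal_def exponents_def)

lemma mpoly_ring_simps:
  "x \<otimes>\<^bsub>mpoly_ring E\<^esub> y = x * y" "x \<oplus>\<^bsub>mpoly_ring E\<^esub> y = x + y"
  "\<one>\<^bsub>mpoly_ring E\<^esub> = 1" "\<zero>\<^bsub>mpoly_ring E\<^esub> = 0"
  by (simp_all add: mpoly_ring_def)

lemma monomial_ideal_zero: "0 \<in> monomial_ideal X"
  by (simp add: monomial_ideal_def)

lemma monomial_ideal_add: "p \<in> monomial_ideal X \<Longrightarrow> q \<in> monomial_ideal X \<Longrightarrow> p + q \<in> monomial_ideal X"
  unfolding monomial_ideal_def using Poly_Mapping.keys_add[of p q] by blast

lemma monomial_ideal_mult:
  "p \<in> monomial_ideal X \<Longrightarrow> q \<in> monomial_ideal Y \<Longrightarrow> p * q \<in> monomial_ideal (minkowski_sum X Y)"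
  unfolding monomial_ideal_def minkowski_sum_def using keys_mult[of p q] by blast

lemma monomial_ideal_mono: "X \<subseteq> Y \<Longrightarrow> monomial_ideal X \<subseteq> monomial_ideal Y"
  by (auto simp: monomial_ideal_def)

text \<open>
  From here on, containments between symbolic and ordinary powers are statements about exponents.
\<close>

lemma monomial_ideal_subset_iff:
  "monomial_ideal X \<subseteq> (monomial_ideal Y :: ('e, 'k::field) mpoly set) \<longleftrightarrow> X \<subseteq> Y"
proof
  assume *: "monomial_ideal X \<subseteq> (monomial_ideal Y :: ('e, 'k) mpoly set)"
  show "X \<subseteq> Y"
  proof
    fix a assume "a \<in> X"
    then have "Poly_Mapping.single a (1::'k) \<in> monomial_ideal X"
      by (simp add: monomial_ideal_def)
    then have "Poly_Mapping.single a (1::'k) \<in> monomial_ideal Y"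
      using * by blast
    then show "a \<in> Y"
      by (simp add: monomial_ideal_def)
  qed
qed (rule monomial_ideal_mono)

lemma monomial_ideal_is_ideal:
  assumes "upset E X"
  shows "ideal (monomial_ideal X) (mpoly_ring E :: ('e, 'k::field) mpoly ring)"
proof -
  let ?R = "mpoly_ring E :: ('e, 'k) mpoly ring"
  interpret cring ?R by (rule mpoly_ring_cring)
  have XE: "X \<subseteq> exponents E" using assms by (simp add: upset_def)
  then have carr: "p \<in> carrier ?R" if "p \<in> monomial_ideal X" for p
    using that by (auto simp: carrier_mpoly_ring monomial_ideal_def)
  have minus: "\<ominus>\<^bsub>?R\<^esub> p = - p" if "p \<in> carrier ?R" for p
  proof (rule minus_equality)
    show "- p \<in> carrier ?R" using that by (simp add: carrier_mpoly_ring monomial_ideal_def)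
  qed (use that in \<open>simp_all add: mpoly_ring_simps\<close>)
  have absorb: "p * q \<in> monomial_ideal X" if "p \<in> monomial_ideal X" "q \<in> carrier ?R" for p q :: "('e, 'k) mpoly"
  proof -
    have "minkowski_sum X (exponents E) \<subseteq> X"
      using assms by (auto simp: minkowski_sum_def upset_def)
    moreover have "p * q \<in> monomial_ideal (minkowski_sum X (exponents E))"
      using that by (auto simp: carrier_mpoly_ring intro: monomial_ideal_mult)
    ultimately show ?thesis
      using monomial_ideal_mono by blast
  qed
  show ?thesis
  proof (rule idealI)
    show "ring ?R" by (rule ring_axioms)
    show "subgroup (monomial_ideal X) (add_monoid ?R)"
    proof (rule add.subgroupI)
      fix p :: "('e, 'k) mpoly" assume p: "p \<in> monomial_ideal X"
      have "\<ominus>\<^bsub>?R\<^esub> p = - p" by (rule minus[OF carr[OF p]])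
      then show "\<ominus>\<^bsub>?R\<^esub> p \<in> monomial_ideal X"
        using p by (simp add: monomial_ideal_def)
    qed (use carr in \<open>auto simp: mpoly_ring_simps monomial_ideal_add intro: monomial_ideal_zero\<close>)
  next
    fix p q :: "('e, 'k) mpoly" assume "p \<in> monomial_ideal X" "q \<in> carrier ?R"
    then show "q \<otimes>\<^bsub>?R\<^esub> p \<in> monomial_ideal X" "p \<otimes>\<^bsub>?R\<^esub> q \<in> monomial_ideal X"
      using absorb[of p q] by (simp_all add: mpoly_ring_simps mult.commute)
  qed
qed

lemma mpoly_eq_sum_monomials:
  fixes p :: "('e, 'k::field) mpoly"
  shows "p = (\<Sum>m\<in>Poly_Mapping.keys p. Poly_Mapping.single m (Poly_Mapping.lookup p m))"
  by (rule poly_mapping_eqI)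
    (auto simp: lookup_sum lookup_single when_def in_keys_iff)

text \<open>
  Membership of a polynomial in an ideal is thereby reduced to its terms.
\<close>

lemma in_additive_set_if_terms_in:
  fixes p :: "('e, 'k::field) mpoly"
  assumes "0 \<in> J" and "\<And>f g. f \<in> J \<Longrightarrow> g \<in> J \<Longrightarrow> f + g \<in> J"
    and "\<And>m c. m \<in> Poly_Mapping.keys p \<Longrightarrow> Poly_Mapping.single m c \<in> J"
  shows "p \<in> J"
proof -
  have "(\<Sum>m\<in>A. Poly_Mapping.single m (Poly_Mapping.lookup p m)) \<in> J"
    if "finite A" "A \<subseteq> Poly_Mapping.keys p" for A
    using that by (induction A rule: finite_induct) (auto intro: assms)
  from this[OF _ order.refl] show ?thesis
    by (simp flip: mpoly_eq_sum_monomials)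
qed

lemma monomial_ideal_prod:
  "ideal_prod (mpoly_ring E) (monomial_ideal X) (monomial_ideal Y)
     = (monomial_ideal (minkowski_sum X Y) :: ('e, 'k::field) mpoly set)"
proof (intro equalityI subsetI)
  fix p :: "('e, 'k) mpoly"
  assume "p \<in> ideal_prod (mpoly_ring E) (monomial_ideal X) (monomial_ideal Y)"
  then show "p \<in> monomial_ideal (minkowski_sum X Y)"
    by induction (auto simp: mpoly_ring_simps intro: monomial_ideal_mult monomial_ideal_add)
next
  fix p :: "('e, 'k) mpoly"
  let ?P = "ideal_prod (mpoly_ring E) (monomial_ideal X) (monomial_ideal Y) :: ('e, 'k) mpoly set"
  assume p: "p \<in> monomial_ideal (minkowski_sum X Y)"
  have prodI: "f * g \<in> ?P" if "f \<in> monomial_ideal X" "g \<in> monomial_ideal Y" for f g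
    using ideal_prod.prod[OF that, of "mpoly_ring E"] by (simp add: mpoly_ring_simps)
  show "p \<in> ?P"
  proof (rule in_additive_set_if_terms_in)
    show "0 \<in> ?P" using prodI[of 0 0] by (simp add: monomial_ideal_zero)
    show "f + g \<in> ?P" if "f \<in> ?P" "g \<in> ?P" for f g
      using ideal_prod.sum[OF that] by (simp add: mpoly_ring_simps)
  next
    fix m and c :: 'k assume "m \<in> Poly_Mapping.keys p"
    then obtain x y where "x \<in> X" "y \<in> Y" "m = x + y"
      using p by (auto simp: monomial_ideal_def minkowski_sum_def)
    moreover from this have "Poly_Mapping.single x c * Poly_Mapping.single y 1 \<in> ?P"
      by (intro prodI) (auto simp: monomial_ideal_def)
    ultimately show "Poly_Mapping.single m c \<in> ?P"
      by (simp add: mult_single)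
  qed
qed

lemma ideal_power_monomial_ideal:
  "ideal_power (mpoly_ring E) (monomial_ideal X) n
     = (monomial_ideal (nfold_sum E X n) :: ('e, 'k::field) mpoly set)"
proof (induction n)
  case 0
  show ?case
    by (simp add: ideal_power_def nat_pow_def ideals_set_def carrier_mpoly_ring)
next
  case (Suc n)
  then show ?case
    by (simp add: ideal_power_def nat_pow_def ideals_set_def monomial_ideal_prod)
qed

lemma initial_degree_monomial_ideal:
  "initial_degree (monomial_ideal X :: ('e, 'k::field) mpoly set) = (LEAST d. \<exists>a\<in>X. monom_degree a = d)"
proof -
  have "(\<exists>f\<in>monomial_ideal X :: ('e, 'k) mpoly set. f \<noteq> 0 \<and> homogeneous d f)
        \<longleftrightarrow> (\<exists>a\<in>X. monom_degree a = d)" for d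
  proof
    assume "\<exists>f\<in>monomial_ideal X :: ('e, 'k) mpoly set. f \<noteq> 0 \<and> homogeneous d f"
    then obtain f :: "('e, 'k) mpoly" where f: "f \<in> monomial_ideal X" "f \<noteq> 0" "homogeneous d f"
      by blast
    then obtain a where "a \<in> Poly_Mapping.keys f"
      using keys_eq_empty by fastforce
    then show "\<exists>a\<in>X. monom_degree a = d"
      using f by (auto simp: monomial_ideal_def homogeneous_def)
  next
    assume "\<exists>a\<in>X. monom_degree a = d"
    then obtain a where "a \<in> X" "monom_degree a = d" by blast
    then show "\<exists>f\<in>monomial_ideal X :: ('e, 'k) mpoly set. f \<noteq> 0 \<and> homogeneous d f"
      by (intro bexI[of _ "Poly_Mapping.single a 1"])
        (auto simp: monomial_ideal_def homogeneous_def simp flip: keys_eq_empty)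
  qed
  then show ?thesis
    by (simp add: initial_degree_def)
qed

section \<open>Squarefree monomial ideals: minimal primes and symbolic powers\<close>

text \<open>
  These are the exponents of the monomials in the ideal generated by the squarefree monomials
  with supports in \<open>\<B>\<close>, and of those in the ideal generated by the variables in \<open>C\<close>, respectively.
\<close>

definition exponents_above :: "'e set \<Rightarrow> 'e set set \<Rightarrow> ('e \<Rightarrow>\<^sub>0 nat) set" where
  "exponents_above E \<B> = {a \<in> exponents E. \<exists>B\<in>\<B>. B \<subseteq> Poly_Mapping.keys a}"

definition exponents_meeting :: "'e set \<Rightarrow> 'e set \<Rightarrow> ('e \<Rightarrow>\<^sub>0 nat) set" where
  "exponents_meeting E C = {a \<in> exponents E. Poly_Mapping.keys a \<inter> C \<noteq> {}}"

definition transversal :: "'e set set \<Rightarrow> 'e set \<Rightarrow> bool" where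
  "transversal \<B> C \<longleftrightarrow> (\<forall>B\<in>\<B>. B \<inter> C \<noteq> {})"

definition minimal_transversals :: "'e set \<Rightarrow> 'e set set \<Rightarrow> 'e set set" where
  "minimal_transversals E \<B> =
     {C. C \<subseteq> E \<and> transversal \<B> C \<and> (\<forall>D. D \<subset> C \<longrightarrow> \<not> transversal \<B> D)}"

lemma keys_add_nat: "Poly_Mapping.keys (a + b :: 'e \<Rightarrow>\<^sub>0 nat) = Poly_Mapping.keys a \<union> Poly_Mapping.keys b"
  by (auto simp: in_keys_iff lookup_add)

lemma upset_exponents_above: "upset E (exponents_above E \<B>)"
  by (auto simp: upset_def exponents_above_def exponents_def keys_add_nat intro: le_supI1)

lemma upset_exponents_meeting: "upset E (exponents_meeting E C)"
  by (auto simp: upset_def exponents_meeting_def exponents_def keys_add_nat)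

definition exponent_on :: "'e set \<Rightarrow> ('e \<Rightarrow> nat) \<Rightarrow> 'e \<Rightarrow>\<^sub>0 nat" where
  "exponent_on B f = (\<Sum>e\<in>B. Poly_Mapping.single e (f e))"

definition indicator_exponent :: "'e set \<Rightarrow> 'e \<Rightarrow>\<^sub>0 nat" where
  "indicator_exponent B = exponent_on B (\<lambda>_. 1)"

lemma lookup_exponent_on:
  "finite B \<Longrightarrow> Poly_Mapping.lookup (exponent_on B f) e = (if e \<in> B then f e else 0)"
  by (simp add: exponent_on_def lookup_sum lookup_single when_def)

lemma exponent_on_in_exponents: "finite E \<Longrightarrow> exponent_on E f \<in> exponents E"
  by (auto simp: exponents_def in_keys_iff lookup_exponent_on split: if_splits)

lemma lookup_indicator_exponent:
  "finite B \<Longrightarrow> Poly_Mapping.lookup (indicator_exponent B) e = (if e \<in> B then 1 else 0)"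
  by (simp add: indicator_exponent_def lookup_exponent_on)

lemma keys_indicator_exponent: "finite B \<Longrightarrow> Poly_Mapping.keys (indicator_exponent B) = B"
  by (auto simp: in_keys_iff lookup_indicator_exponent split: if_splits)

lemma prod_mvar:
  "finite B \<Longrightarrow> (\<Prod>e\<in>B. mvar e) = (Poly_Mapping.single (indicator_exponent B) 1 :: ('e, 'k::field) mpoly)"
proof (induction B rule: finite_induct)
  case empty
  then show ?case by (simp add: indicator_exponent_def exponent_on_def)
next
  case (insert e B)
  then show ?case
    by (simp add: mvar_def mult_single indicator_exponent_def exponent_on_def)
qed

lemma exponent_diff:
  fixes a b :: "'e \<Rightarrow>\<^sub>0 nat"
  assumes "\<And>e. Poly_Mapping.lookup b e \<le> Poly_Mapping.lookup a e"
  shows "a = (a - b) + b"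
  by (rule poly_mapping_eqI) (simp add: lookup_add lookup_minus assms)

lemma diff_in_exponents: "a \<in> exponents E \<Longrightarrow> a - b \<in> exponents E"
  by (auto simp: exponents_def in_keys_iff lookup_minus)

lemma indicator_exponent_le:
  assumes "finite B" "B \<subseteq> Poly_Mapping.keys a"
  shows "Poly_Mapping.lookup (indicator_exponent B) e \<le> Poly_Mapping.lookup a e"
  using assms by (auto simp: lookup_indicator_exponent in_keys_iff Suc_le_eq subset_iff)

lemma genideal_squarefree_monomials:
  assumes "finite E" "\<And>B. B \<in> \<B> \<Longrightarrow> B \<subseteq> E"
  shows "Idl\<^bsub>mpoly_ring E\<^esub> {\<Prod>e\<in>B. mvar e | B. B \<in> \<B>}
           = (monomial_ideal (exponents_above E \<B>) :: ('e, 'k::field) mpoly set)"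
proof -
  let ?R = "mpoly_ring E :: ('e, 'k) mpoly ring"
  interpret cring ?R by (rule mpoly_ring_cring)
  let ?S = "{\<Prod>e\<in>B. mvar e | B. B \<in> \<B>} :: ('e, 'k) mpoly set"
  have fin: "finite B" if "B \<in> \<B>" for B
    using that assms finite_subset by blast
  have S: "?S \<subseteq> monomial_ideal (exponents_above E \<B>)"
    using assms(2) by (fastforce simp: fin prod_mvar monomial_ideal_def exponents_above_def exponents_def
        keys_indicator_exponent)
  have "exponents_above E \<B> \<subseteq> exponents E"
    by (auto simp: exponents_above_def)
  then have SR: "?S \<subseteq> carrier ?R"
    unfolding carrier_mpoly_ring using S monomial_ideal_mono by blast
  show ?thesis
  proof
    show "Idl\<^bsub>?R\<^esub> ?S \<subseteq> monomial_ideal (exponents_above E \<B>)"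
      by (rule genideal_minimal[OF monomial_ideal_is_ideal[OF upset_exponents_above] S])
    show "monomial_ideal (exponents_above E \<B>) \<subseteq> Idl\<^bsub>?R\<^esub> ?S"
    proof
      fix p :: "('e, 'k) mpoly" assume p: "p \<in> monomial_ideal (exponents_above E \<B>)"
      interpret I: ideal "Idl\<^bsub>?R\<^esub> ?S" ?R by (rule genideal_ideal[OF SR])
      show "p \<in> Idl\<^bsub>?R\<^esub> ?S"
      proof (rule in_additive_set_if_terms_in)
        show "0 \<in> Idl\<^bsub>?R\<^esub> ?S" using I.zero_closed by (simp add: mpoly_ring_simps)
        show "f + g \<in> Idl\<^bsub>?R\<^esub> ?S" if "f \<in> Idl\<^bsub>?R\<^esub> ?S" "g \<in> Idl\<^bsub>?R\<^esub> ?S" for f g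
          using I.a_closed[OF that] by (simp add: mpoly_ring_simps)
      next
        fix a and c :: 'k assume "a \<in> Poly_Mapping.keys p"
        then obtain B where a: "a \<in> exponents E" and B: "B \<in> \<B>" "B \<subseteq> Poly_Mapping.keys a"
          using p by (auto simp: monomial_ideal_def exponents_above_def)
        let ?b = "indicator_exponent B"
        have "Poly_Mapping.single a c = Poly_Mapping.single (a - ?b) c * (\<Prod>e\<in>B. mvar e)"
          using exponent_diff[of ?b a] indicator_exponent_le[OF fin B(2)] B(1)
          by (simp add: fin prod_mvar mult_single)
        moreover have "Poly_Mapping.single (a - ?b) c \<in> carrier ?R"
          using diff_in_exponents[OF a] by (auto simp: carrier_mpoly_ring monomial_ideal_def)
        moreover have "(\<Prod>e\<in>B. mvar e) \<in> Idl\<^bsub>?R\<^esub> ?S"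
          using genideal_self[OF SR] B(1) by blast
        ultimately show "Poly_Mapping.single a c \<in> Idl\<^bsub>?R\<^esub> ?S"
          using I.I_l_closed[of "\<Prod>e\<in>B. mvar e" "Poly_Mapping.single (a - ?b) c"]
          by (simp add: mpoly_ring_simps)
      qed
    qed
  qed
qed

text \<open>
  A substitute for a monomial order: reading the exponents in \<open>X\<close> as digits in a large base turns
  them into distinct numbers.
\<close>

lemma exists_injective_weight:
  fixes X :: "('e \<Rightarrow>\<^sub>0 nat) set"
  assumes "finite E" "finite X" "X \<subseteq> exponents E"
  shows "\<exists>w. inj_on (\<lambda>a. \<Sum>e\<in>E. w e * Poly_Mapping.lookup a e) X"
proof -
  have "\<exists>w. \<forall>a\<in>X. \<forall>b\<in>X. (\<Sum>e\<in>E. w e * Poly_Mapping.lookup a e) = (\<Sum>e\<in>E. w e * Poly_Mapping.lookup b e)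
       \<longrightarrow> (\<forall>e\<in>E. Poly_Mapping.lookup a e = Poly_Mapping.lookup b e)"
    using \<open>finite E\<close>
  proof (induction E rule: finite_induct)
    case empty
    then show ?case by simp
  next
    case (insert x F)
    then obtain w where w: "\<forall>a\<in>X. \<forall>b\<in>X. (\<Sum>e\<in>F. w e * Poly_Mapping.lookup a e) = (\<Sum>e\<in>F. w e * Poly_Mapping.lookup b e)
       \<longrightarrow> (\<forall>e\<in>F. Poly_Mapping.lookup a e = Poly_Mapping.lookup b e)" by blast
    \<comment> \<open>\<open>N\<close> is the base: larger than every exponent of \<open>x\<close> that occurs in \<open>X\<close>.\<close>
    define N where "N = Suc (\<Sum>a\<in>X. Poly_Mapping.lookup a x)"
    have less: "Poly_Mapping.lookup a x < N" if "a \<in> X" for a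
      unfolding N_def using member_le_sum[OF that, of "\<lambda>a. Poly_Mapping.lookup a x"] \<open>finite X\<close> by simp
    define v where "v e = (if e = x then 1 else N * w e)" for e
    have sum_v: "(\<Sum>e\<in>insert x F. v e * Poly_Mapping.lookup a e)
          = Poly_Mapping.lookup a x + N * (\<Sum>e\<in>F. w e * Poly_Mapping.lookup a e)" for a
    proof -
      have "(\<Sum>e\<in>F. v e * Poly_Mapping.lookup a e) = (\<Sum>e\<in>F. N * (w e * Poly_Mapping.lookup a e))"
        using insert.hyps by (intro sum.cong) (auto simp: v_def)
      then show ?thesis
        using insert.hyps by (simp add: v_def sum_distrib_left)
    qed
    show ?case
    proof (intro exI[of _ v] ballI impI)
      fix a b e assume ab: "a \<in> X" "b \<in> X" and e: "e \<in> insert x F"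
        and eq: "(\<Sum>e\<in>insert x F. v e * Poly_Mapping.lookup a e) = (\<Sum>e\<in>insert x F. v e * Poly_Mapping.lookup b e)"
      have "(Poly_Mapping.lookup a x + N * (\<Sum>e\<in>F. w e * Poly_Mapping.lookup a e)) mod N
          = (Poly_Mapping.lookup b x + N * (\<Sum>e\<in>F. w e * Poly_Mapping.lookup b e)) mod N"
        using eq by (simp only: sum_v)
      then have x: "Poly_Mapping.lookup a x = Poly_Mapping.lookup b x"
        using less ab by simp
      then have "N * (\<Sum>e\<in>F. w e * Poly_Mapping.lookup a e) = N * (\<Sum>e\<in>F. w e * Poly_Mapping.lookup b e)"
        using eq by (simp only: sum_v)
      then have "(\<Sum>e\<in>F. w e * Poly_Mapping.lookup a e) = (\<Sum>e\<in>F. w e * Poly_Mapping.lookup b e)"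
        by (simp only: mult_cancel_left) (simp add: N_def)
      with w ab e x show "Poly_Mapping.lookup a e = Poly_Mapping.lookup b e" by blast
    qed
  qed
  then obtain w where w: "\<forall>a\<in>X. \<forall>b\<in>X. (\<Sum>e\<in>E. w e * Poly_Mapping.lookup a e) = (\<Sum>e\<in>E. w e * Poly_Mapping.lookup b e)
       \<longrightarrow> (\<forall>e\<in>E. Poly_Mapping.lookup a e = Poly_Mapping.lookup b e)" by blast
  show ?thesis
  proof (intro exI[of _ w] inj_onI poly_mapping_eqI)
    fix a b e assume ab: "a \<in> X" "b \<in> X"
      and "(\<Sum>e\<in>E. w e * Poly_Mapping.lookup a e) = (\<Sum>e\<in>E. w e * Poly_Mapping.lookup b e)"
    then have "\<forall>e\<in>E. Poly_Mapping.lookup a e = Poly_Mapping.lookup b e" using w by blast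
    moreover have "Poly_Mapping.lookup a e = 0" "Poly_Mapping.lookup b e = 0" if "e \<notin> E"
      using ab assms(3) that by (auto simp: exponents_def in_keys_iff subset_iff)
    ultimately show "Poly_Mapping.lookup a e = Poly_Mapping.lookup b e" by (cases "e \<in> E") auto
  qed
qed

lemma lookup_mult_unique_decomposition:
  fixes p q :: "('e, 'k::field) mpoly"
  assumes "\<And>x y. x \<in> Poly_Mapping.keys p \<Longrightarrow> y \<in> Poly_Mapping.keys q \<Longrightarrow> x + y = a + b \<Longrightarrow> x = a \<and> y = b"
  shows "Poly_Mapping.lookup (p * q) (a + b) = Poly_Mapping.lookup p a * Poly_Mapping.lookup q b"
proof -
  have inner: "Poly_Mapping.lookup p l * (\<Sum>y. (Poly_Mapping.lookup q y when a + b = l + y))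
      = (Poly_Mapping.lookup p a * Poly_Mapping.lookup q b when l = a)" for l
  proof (cases "l = a")
    case True
    then show ?thesis by (simp add: add_left_cancel)
  next
    case False
    have "(Poly_Mapping.lookup q y when a + b = l + y) = 0" if "l \<in> Poly_Mapping.keys p" for y
      using assms[OF that, of y] False
      by (cases "y \<in> Poly_Mapping.keys q") (auto simp: when_def not_in_keys_iff_lookup_eq_zero)
    then have "Poly_Mapping.lookup p l * (\<Sum>y. (Poly_Mapping.lookup q y when a + b = l + y)) = 0"
      by (cases "l \<in> Poly_Mapping.keys p") (auto simp: in_keys_iff)
    then show ?thesis using False by simp
  qed
  show ?thesis
    unfolding lookup_mult inner by simp
qed

text \<open>
  If neither \<open>p\<close> nor \<open>q\<close> is in the ideal, both have monomials without variables in \<open>C\<close>. Take those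
  of largest weight, for a weight that separates these monomials: their product arises in only one
  way, so it does not cancel in \<open>p * q\<close>.
\<close>

lemma primeideal_variables:
  assumes "finite E"
  shows "primeideal (monomial_ideal (exponents_meeting E C)) (mpoly_ring E :: ('e, 'k::field) mpoly ring)"
proof -
  let ?R = "mpoly_ring E :: ('e, 'k) mpoly ring"
  let ?P = "monomial_ideal (exponents_meeting E C) :: ('e, 'k) mpoly set"
  interpret cring ?R by (rule mpoly_ring_cring)
  show ?thesis
  proof (rule primeidealI)
    show "ideal ?P ?R" by (rule monomial_ideal_is_ideal[OF upset_exponents_meeting])
    show "cring ?R" by (rule mpoly_ring_cring)
    have "(1 :: ('e, 'k) mpoly) \<in> carrier ?R" "(1 :: ('e, 'k) mpoly) \<notin> ?P"
      by (auto simp: carrier_mpoly_ring monomial_ideal_def exponents_meeting_def)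
    then show "carrier ?R \<noteq> ?P" by blast
  next
    fix p q assume p: "p \<in> carrier ?R" and q: "q \<in> carrier ?R"
      and "p \<otimes>\<^bsub>?R\<^esub> q \<in> ?P"
    then have pq: "p * q \<in> ?P" by (simp add: mpoly_ring_simps)
    define clean where "clean f = {a \<in> Poly_Mapping.keys f. Poly_Mapping.keys a \<inter> C = {}}" for f :: "('e, 'k) mpoly"
    show "p \<in> ?P \<or> q \<in> ?P"
    proof (rule ccontr)
      assume "\<not> (p \<in> ?P \<or> q \<in> ?P)"
      then have ne: "clean p \<noteq> {}" "clean q \<noteq> {}"
        using p q by (auto simp: clean_def carrier_mpoly_ring monomial_ideal_def exponents_meeting_def)
      have fin: "finite (clean p)" "finite (clean q)" by (simp_all add: clean_def)
      have "clean p \<union> clean q \<subseteq> exponents E"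
        using p q by (auto simp: clean_def carrier_mpoly_ring monomial_ideal_def)
      then obtain w where w: "inj_on (\<lambda>a. \<Sum>e\<in>E. w e * Poly_Mapping.lookup a e) (clean p \<union> clean q)"
        using exists_injective_weight[OF assms, of "clean p \<union> clean q"] fin by blast
      define L where "L a = (\<Sum>e\<in>E. w e * Poly_Mapping.lookup a e)" for a
      have L_add: "L (a + b) = L a + L b" for a b
        by (simp add: L_def lookup_add distrib_left sum.distrib)
      have max: "\<exists>a\<in>clean f. \<forall>b\<in>clean f. L b \<le> L a" if "clean f \<noteq> {}" for f
      proof -
        have fin: "finite (L ` clean f)" by (simp add: clean_def)
        have "Max (L ` clean f) \<in> L ` clean f" using fin that by (intro Max_in) auto
        then obtain a where "a \<in> clean f" "Max (L ` clean f) = L a" by blast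
        moreover have "L b \<le> Max (L ` clean f)" if "b \<in> clean f" for b
          using fin that by simp
        ultimately show ?thesis by auto
      qed
      obtain a where a: "a \<in> clean p" "\<And>x. x \<in> clean p \<Longrightarrow> L x \<le> L a" using max[OF ne(1)] by blast
      obtain b where b: "b \<in> clean q" "\<And>x. x \<in> clean q \<Longrightarrow> L x \<le> L b" using max[OF ne(2)] by blast
      have "Poly_Mapping.lookup (p * q) (a + b) = Poly_Mapping.lookup p a * Poly_Mapping.lookup q b"
      proof (rule lookup_mult_unique_decomposition)
        fix x y assume xy: "x \<in> Poly_Mapping.keys p" "y \<in> Poly_Mapping.keys q" "x + y = a + b"
        then have "Poly_Mapping.keys x \<union> Poly_Mapping.keys y = Poly_Mapping.keys a \<union> Poly_Mapping.keys b"
          by (simp flip: keys_add_nat)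
        then have cl: "x \<in> clean p" "y \<in> clean q"
          using xy a(1) b(1) unfolding clean_def by blast+
        have "L x + L y = L a + L b" using xy(3) by (simp flip: L_add)
        with a(2)[OF cl(1)] b(2)[OF cl(2)] have "L x = L a" "L y = L b" by linarith+
        then show "x = a \<and> y = b"
          using w cl a(1) b(1) unfolding L_def inj_on_def by blast
      qed
      also have "\<dots> \<noteq> 0" using a(1) b(1) by (auto simp: clean_def in_keys_iff)
      finally have "a + b \<in> Poly_Mapping.keys (p * q)" by (simp add: in_keys_iff)
      then have "Poly_Mapping.keys (a + b) \<inter> C \<noteq> {}"
        using pq by (auto simp: monomial_ideal_def exponents_meeting_def)
      then show False
        using a(1) b(1) by (auto simp: clean_def keys_add_nat)
    qed
  qed
qed

lemma transversal_contains_minimal: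
  assumes "finite E" "C \<subseteq> E" "transversal \<B> C"
  shows "\<exists>D\<in>minimal_transversals E \<B>. D \<subseteq> C"
proof -
  have "finite C" using assms finite_subset by blast
  then show ?thesis using assms(2,3)
  proof (induction C rule: finite_psubset_induct)
    case (psubset C)
    show ?case
    proof (cases "\<exists>D. D \<subset> C \<and> transversal \<B> D")
      case True
      then obtain D where D: "D \<subset> C" "transversal \<B> D" by blast
      with psubset.IH[of D] psubset.prems show ?thesis by blast
    next
      case False
      then have "C \<in> minimal_transversals E \<B>"
        using psubset.prems by (auto simp: minimal_transversals_def)
      then show ?thesis by blast
    qed
  qed
qed

lemma prime_contains_variable:
  assumes "primeideal Q (mpoly_ring E :: ('e, 'k::field) mpoly ring)" "finite B" "B \<subseteq> E"
    and "(\<Prod>e\<in>B. mvar e) \<in> Q"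
  shows "\<exists>e\<in>B. mvar e \<in> Q"
  using assms(2,3,4)
proof (induction B rule: finite_induct)
  case empty
  interpret primeideal Q "mpoly_ring E :: ('e, 'k) mpoly ring" by fact
  have "\<one>\<^bsub>mpoly_ring E\<^esub> \<in> Q" using empty by (simp add: mpoly_ring_simps)
  then show ?case using one_imp_carrier I_notcarr by blast
next
  case (insert x B)
  interpret primeideal Q "mpoly_ring E :: ('e, 'k) mpoly ring" by fact
  have "mvar x \<in> carrier (mpoly_ring E :: ('e, 'k) mpoly ring)"
    using insert.prems by (simp add: mpoly_ring_def mvar_def)
  moreover have "(\<Prod>e\<in>B. mvar e) \<in> carrier (mpoly_ring E :: ('e, 'k) mpoly ring)"
    unfolding prod_mvar[OF insert.hyps(1)]
    using insert.prems insert.hyps by (simp add: mpoly_ring_def keys_indicator_exponent)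
  ultimately have "mvar x \<in> Q \<or> (\<Prod>e\<in>B. mvar e) \<in> Q"
    using I_prime insert by (simp add: mpoly_ring_simps)
  with insert show ?case by auto
qed

lemma variable_ideal_least:
  assumes "ideal Q (mpoly_ring E :: ('e, 'k::field) mpoly ring)"
    and "C \<subseteq> E" "\<And>e. e \<in> C \<Longrightarrow> mvar e \<in> Q"
  shows "monomial_ideal (exponents_meeting E C) \<subseteq> Q"
proof
  interpret ideal Q "mpoly_ring E :: ('e, 'k) mpoly ring" by fact
  fix p :: "('e, 'k) mpoly" assume p: "p \<in> monomial_ideal (exponents_meeting E C)"
  show "p \<in> Q"
  proof (rule in_additive_set_if_terms_in)
    show "0 \<in> Q"
      using additive_subgroup.zero_closed[OF is_additive_subgroup] by (simp add: mpoly_ring_simps)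
    show "f + g \<in> Q" if "f \<in> Q" "g \<in> Q" for f g
      using additive_subgroup.a_closed[OF is_additive_subgroup that] by (simp add: mpoly_ring_simps)
  next
    fix a and c :: 'k assume "a \<in> Poly_Mapping.keys p"
    then obtain e where a: "a \<in> exponents E" and e: "e \<in> C" "e \<in> Poly_Mapping.keys a"
      using p by (auto simp: monomial_ideal_def exponents_meeting_def)
    let ?b = "Poly_Mapping.single e (1::nat)"
    have "a = (a - ?b) + ?b"
      by (rule exponent_diff) (use e(2) in \<open>auto simp: lookup_single when_def in_keys_iff\<close>)
    then have "Poly_Mapping.single a c = Poly_Mapping.single (a - ?b) c * mvar e"
      by (simp add: mvar_def mult_single)
    moreover have "Poly_Mapping.single (a - ?b) c \<in> carrier (mpoly_ring E)"
      using diff_in_exponents[OF a] by (auto simp: carrier_mpoly_ring monomial_ideal_def)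
    ultimately show "Poly_Mapping.single a c \<in> Q"
      using I_l_closed[of "mvar e" "Poly_Mapping.single (a - ?b) c"] assms(3)[OF e(1)]
      by (simp add: mpoly_ring_simps)
  qed
qed

text \<open>
  A prime contains the ideal iff its variables meet every generator. So a minimal transversal
  gives a prime containing the ideal, and every prime containing the ideal contains one of these.
\<close>

lemma minimal_primes_squarefree:
  assumes "finite E" "\<And>B. B \<in> \<B> \<Longrightarrow> B \<subseteq> E"
  shows "minimal_primes (mpoly_ring E) (monomial_ideal (exponents_above E \<B>) :: ('e, 'k::field) mpoly set)
           = (\<lambda>C. monomial_ideal (exponents_meeting E C)) ` minimal_transversals E \<B>"
proof -
  let ?R = "mpoly_ring E :: ('e, 'k) mpoly ring"
  let ?I = "monomial_ideal (exponents_above E \<B>) :: ('e, 'k) mpoly set"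
  let ?P = "\<lambda>C. monomial_ideal (exponents_meeting E C) :: ('e, 'k) mpoly set"
  have fin: "finite B" if "B \<in> \<B>" for B
    using that assms finite_subset by blast
  have I_le_P: "?I \<subseteq> ?P C" if "transversal \<B> C" for C
    unfolding monomial_ideal_subset_iff
    using that by (fastforce simp: exponents_above_def exponents_meeting_def transversal_def)
  have mvar_P: "mvar e \<in> ?P C \<longleftrightarrow> e \<in> C" if "e \<in> E" for e C
    using that by (auto simp: mvar_def monomial_ideal_def exponents_meeting_def exponents_def)
  have var_in: "\<exists>e\<in>B. mvar e \<in> Q" if "primeideal Q ?R" "?I \<subseteq> Q" "B \<in> \<B>" for Q B
  proof (rule prime_contains_variable[OF that(1) fin[OF that(3)] assms(2)[OF that(3)]])
    have "(\<Prod>e\<in>B. mvar e) \<in> ?I"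
      using that(3) assms(2)[OF that(3)]
      by (auto simp: fin prod_mvar monomial_ideal_def exponents_above_def exponents_def keys_indicator_exponent)
    then show "(\<Prod>e\<in>B. mvar e) \<in> Q" using that(2) by blast
  qed
  have P_min: "?P C \<in> minimal_primes ?R ?I" if C: "C \<in> minimal_transversals E \<B>" for C
    unfolding minimal_primes_def
  proof (intro CollectI conjI allI impI)
    have CE: "C \<subseteq> E" and tr: "transversal \<B> C" and mn: "\<And>D. D \<subset> C \<Longrightarrow> \<not> transversal \<B> D"
      using C by (auto simp: minimal_transversals_def)
    show "primeideal (?P C) ?R" by (rule primeideal_variables[OF assms(1)])
    show "?I \<subseteq> ?P C" by (rule I_le_P[OF tr])
    fix Q assume Q: "primeideal Q ?R \<and> ?I \<subseteq> Q \<and> Q \<subseteq> ?P C"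
    have "mvar e \<in> Q" if "e \<in> C" for e
    proof -
      \<comment> \<open>By minimality some generator meets \<open>C\<close> in \<open>e\<close> only.\<close>
      have "\<not> transversal \<B> (C - {e})" using mn[of "C - {e}"] that by blast
      then obtain B where B: "B \<in> \<B>" "B \<inter> C \<subseteq> {e}" by (auto simp: transversal_def)
      then obtain e' where e': "e' \<in> B" "mvar e' \<in> Q" using var_in Q by blast
      then have "e' \<in> C" using Q mvar_P[of e' C] assms(2)[OF B(1)] by blast
      with B e' show ?thesis by blast
    qed
    then have "?P C \<subseteq> Q"
      using Q CE by (intro variable_ideal_least) (auto simp: primeideal_def)
    then show "Q = ?P C" using Q by blast
  qed
  have "Q \<in> ?P ` minimal_transversals E \<B>" if Q: "Q \<in> minimal_primes ?R ?I" for Q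
  proof -
    have Qp: "primeideal Q ?R" "?I \<subseteq> Q"
      and Qm: "\<And>Q'. primeideal Q' ?R \<Longrightarrow> ?I \<subseteq> Q' \<Longrightarrow> Q' \<subseteq> Q \<Longrightarrow> Q' = Q"
      using Q by (auto simp: minimal_primes_def)
    define D where "D = {e \<in> E. mvar e \<in> Q}"
    have "transversal \<B> D"
      unfolding transversal_def D_def using var_in[OF Qp] assms(2) by blast
    then obtain C where C: "C \<in> minimal_transversals E \<B>" "C \<subseteq> D"
      using transversal_contains_minimal[OF assms(1), of D \<B>] by (auto simp: D_def)
    have "?P C \<subseteq> Q"
      using Qp(1) C(2) by (intro variable_ideal_least) (auto simp: primeideal_def D_def)
    moreover have "transversal \<B> C" using C(1) by (simp add: minimal_transversals_def)
    ultimately have "?P C = Q"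
      using Qm primeideal_variables[OF assms(1)] I_le_P by blast
    with C(1) show ?thesis by blast
  qed
  with P_min show ?thesis by blast
qed

text \<open>
  The power of a prime generated by variables is cut out by the degree in these variables.
\<close>

lemma nfold_sum_meeting:
  assumes "finite C" "C \<subseteq> E"
  shows "nfold_sum E (exponents_meeting E C) s = {a \<in> exponents E. s \<le> deg_on C a}"
proof (induction s)
  case 0
  then show ?case by simp
next
  case (Suc s)
  show ?case
  proof (intro equalityI subsetI)
    fix a assume "a \<in> nfold_sum E (exponents_meeting E C) (Suc s)"
    then have "a \<in> minkowski_sum {a \<in> exponents E. s \<le> deg_on C a} (exponents_meeting E C)"
      by (simp add: Suc)
    then obtain x y where a: "a = x + y" and x: "x \<in> exponents E" "s \<le> deg_on C x"
      and y: "y \<in> exponents E" "Poly_Mapping.keys y \<inter> C \<noteq> {}"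
      by (auto simp: minkowski_sum_def exponents_meeting_def)
    from y obtain e where "e \<in> C" "Poly_Mapping.lookup y e \<noteq> 0" by (auto simp: in_keys_iff)
    then have "deg_on C y \<noteq> 0" using assms(1) by (auto simp: deg_on_def)
    then show "a \<in> {a \<in> exponents E. Suc s \<le> deg_on C a}"
      using a x y by (simp add: deg_on_add add_in_exponents)
  next
    fix a assume "a \<in> {a \<in> exponents E. Suc s \<le> deg_on C a}"
    then have a: "a \<in> exponents E" "Suc s \<le> deg_on C a" by auto
    then have "(\<Sum>e\<in>C. Poly_Mapping.lookup a e) \<noteq> 0"
      by (simp add: deg_on_def)
    then obtain e where e: "e \<in> C" "Poly_Mapping.lookup a e \<noteq> 0" by (meson sum.neutral)
    let ?b = "Poly_Mapping.single e (1::nat)"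
    have eq: "a = (a - ?b) + ?b"
      by (rule exponent_diff) (use e(2) in \<open>auto simp: lookup_single when_def in_keys_iff\<close>)
    have "deg_on C ?b = 1"
      using e(1) assms(1) by (simp add: deg_on_def lookup_single when_def)
    then have "s \<le> deg_on C (a - ?b)"
      using a(2) deg_on_add[of C "a - ?b" ?b] eq by simp
    then have "a - ?b \<in> nfold_sum E (exponents_meeting E C) s"
      using a(1) by (simp add: Suc diff_in_exponents)
    moreover have "?b \<in> exponents_meeting E C"
      using e(1) assms(2) by (auto simp: exponents_meeting_def exponents_def)
    ultimately show "a \<in> nfold_sum E (exponents_meeting E C) (Suc s)"
      using eq by (auto simp: minkowski_sum_def)
  qed
qed

definition symbolic_exponents :: "'e set \<Rightarrow> 'e set set \<Rightarrow> nat \<Rightarrow> ('e \<Rightarrow>\<^sub>0 nat) set" where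
  "symbolic_exponents E \<B> s = {a \<in> exponents E. \<forall>C\<in>minimal_transversals E \<B>. s \<le> deg_on C a}"

lemma symbolic_power_squarefree:
  assumes "finite E" "\<And>B. B \<in> \<B> \<Longrightarrow> B \<subseteq> E"
  shows "symbolic_power (mpoly_ring E) (monomial_ideal (exponents_above E \<B>)) s
           = (monomial_ideal (symbolic_exponents E \<B> s) :: ('e, 'k::field) mpoly set)"
proof -
  have "ideal_power (mpoly_ring E) (monomial_ideal (exponents_meeting E C)) s
      = (monomial_ideal {a \<in> exponents E. s \<le> deg_on C a} :: ('e, 'k) mpoly set)"
    if "C \<in> minimal_transversals E \<B>" for C
  proof -
    have "C \<subseteq> E" using that by (simp add: minimal_transversals_def)
    moreover from this have "finite C" using assms(1) finite_subset by blast
    ultimately show ?thesis by (simp add: ideal_power_monomial_ideal nfold_sum_meeting)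
  qed
  then have "symbolic_power (mpoly_ring E) (monomial_ideal (exponents_above E \<B>)) s
      = (monomial_ideal (exponents E) :: ('e, 'k) mpoly set)
        \<inter> (\<Inter>C\<in>minimal_transversals E \<B>. monomial_ideal {a \<in> exponents E. s \<le> deg_on C a})"
    unfolding symbolic_power_def carrier_mpoly_ring
    by (simp add: minimal_primes_squarefree[OF assms])
  also have "\<dots> = monomial_ideal (symbolic_exponents E \<B> s)"
    by (auto simp: monomial_ideal_def symbolic_exponents_def)
  finally show ?thesis .
qed

text \<open>
  The constraints extend to all transversals. In a graph this covers every cut, bond or not.
\<close>

lemma deg_on_transversal_ge:
  assumes "finite E" "a \<in> symbolic_exponents E \<B> s" "C \<subseteq> E" "transversal \<B> C"
  shows "s \<le> deg_on C a"
proof -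
  obtain D where "D \<in> minimal_transversals E \<B>" "D \<subseteq> C"
    using transversal_contains_minimal[OF assms(1,3,4)] by blast
  then show ?thesis
    using assms finite_subset[OF assms(3,1)] deg_on_mono[of C D a]
    by (fastforce simp: symbolic_exponents_def)
qed

lemma deg_on_nfold_sum_ge:
  assumes "\<And>x. x \<in> X \<Longrightarrow> d \<le> deg_on D x" "a \<in> nfold_sum E X r"
  shows "r * d \<le> deg_on D a"
  using assms(2)
proof (induction r arbitrary: a)
  case (Suc r)
  then obtain x y where "a = x + y" "x \<in> nfold_sum E X r" "y \<in> X"
    by (auto simp: minkowski_sum_def)
  with Suc.IH[of x] assms(1)[of y] show ?case by (simp add: deg_on_add)
qed simp

text \<open>
  \<open>N B\<close> is the multiplicity of the generator \<open>B\<close> in a product of generators that divides \<open>x^a\<close>.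
\<close>

lemma nfold_sum_above_if_packing:
  assumes "finite E" "finite \<B>" "\<And>B. B \<in> \<B> \<Longrightarrow> B \<subseteq> E" "a \<in> exponents E"
    and "r \<le> (\<Sum>B\<in>\<B>. N B)"
    and "\<And>e. e \<in> E \<Longrightarrow> (\<Sum>B\<in>{B \<in> \<B>. e \<in> B}. N B) \<le> Poly_Mapping.lookup a e"
  shows "a \<in> nfold_sum E (exponents_above E \<B>) r"
  using assms(4-6)
proof (induction r arbitrary: a N)
  case 0
  then show ?case by simp
next
  case (Suc r)
  then have "(\<Sum>B\<in>\<B>. N B) \<noteq> 0" by linarith
  then obtain B where B: "B \<in> \<B>" "N B \<noteq> 0" by (meson sum.neutral)
  have finB: "finite B" using assms B finite_subset by blast
  let ?b = "indicator_exponent B"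
  define N' where "N' = N(B := N B - 1)"
  have split: "sum N S = sum N' S + (if B \<in> S then 1 else 0)" if "S \<subseteq> \<B>" for S
  proof -
    have "finite S" using that assms(2) finite_subset by blast
    then show ?thesis
      using B(2) by (auto simp: N'_def sum.remove[of S B] intro!: sum.cong)
  qed
  have keys: "B \<subseteq> Poly_Mapping.keys a"
  proof
    fix e assume e: "e \<in> B"
    have "N B \<le> (\<Sum>B\<in>{B \<in> \<B>. e \<in> B}. N B)"
      using B(1) e assms(2) by (intro member_le_sum) auto
    also have "\<dots> \<le> Poly_Mapping.lookup a e" using Suc.prems(3) assms(3) B(1) e by blast
    finally show "e \<in> Poly_Mapping.keys a" using B(2) by (simp add: in_keys_iff)
  qed
  have eq: "a = (a - ?b) + ?b"
    by (rule exponent_diff[OF indicator_exponent_le[OF finB keys]])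
  have "a - ?b \<in> nfold_sum E (exponents_above E \<B>) r"
  proof (rule Suc.IH)
    show "a - ?b \<in> exponents E" by (rule diff_in_exponents) fact
    show "r \<le> (\<Sum>B\<in>\<B>. N' B)" using Suc.prems(2) split[of \<B>] B(1) by simp
  next
    fix e assume e: "e \<in> E"
    have "(\<Sum>B\<in>{B \<in> \<B>. e \<in> B}. N' B) + (if e \<in> B then 1 else 0) \<le> Poly_Mapping.lookup a e"
      using Suc.prems(3)[OF e] split[of "{B \<in> \<B>. e \<in> B}"] B(1) by simp
    then show "(\<Sum>B\<in>{B \<in> \<B>. e \<in> B}. N' B) \<le> Poly_Mapping.lookup (a - ?b) e"
      using finB by (auto simp: lookup_minus lookup_indicator_exponent split: if_splits)
  qed
  moreover have "?b \<in> exponents_above E \<B>"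
    using B(1) assms(3)[OF B(1)] finB
    by (auto simp: exponents_above_def exponents_def keys_indicator_exponent)
  ultimately show ?case
    using eq by (auto simp: minkowski_sum_def)
qed

section \<open>Spanning trees\<close>

definition adj :: "'v set set \<Rightarrow> ('v \<times> 'v) set" where
  "adj F = {(x, y). {x, y} \<in> F}"

definition connects :: "'v set set \<Rightarrow> 'v set \<Rightarrow> bool" where
  "connects F V \<longleftrightarrow> (\<forall>u\<in>V. \<forall>v\<in>V. (u, v) \<in> (adj F)\<^sup>*)"

lemma adj_rtrancl_sym: "(u, v) \<in> (adj F)\<^sup>* \<Longrightarrow> (v, u) \<in> (adj F)\<^sup>*"
proof -
  have "sym (adj F)" by (auto simp: adj_def sym_def insert_commute)
  then show "(u, v) \<in> (adj F)\<^sup>* \<Longrightarrow> (v, u) \<in> (adj F)\<^sup>*"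
    using sym_rtrancl symD by metis
qed

lemma connects_if_steps_connected:
  assumes "connects F V" "\<And>x y. {x, y} \<in> F \<Longrightarrow> (x, y) \<in> (adj F')\<^sup>*"
  shows "connects F' V"
proof -
  have "adj F \<subseteq> (adj F')\<^sup>*" using assms(2) by (auto simp: adj_def)
  then have "(adj F)\<^sup>* \<subseteq> (adj F')\<^sup>*" by (rule rtrancl_subset_rtrancl)
  then show ?thesis using assms(1) by (auto simp: connects_def)
qed

lemma rtrancl_crosses:
  assumes "(u, v) \<in> r\<^sup>*" "u \<in> S" "v \<notin> S"
  shows "\<exists>x y. (x, y) \<in> r \<and> x \<in> S \<and> y \<notin> S"
  using assms by (induction rule: rtrancl_induct) blast+

lemma connected_graph_iff: "connected_graph G \<longleftrightarrow> verts G \<noteq> {} \<and> connects (edges G) (verts G)"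
  by (simp add: connected_graph_def connects_def adj_def)

lemma rtrancl_adj_path:
  assumes "(u, v) \<in> (adj F)\<^sup>*"
  shows "\<exists>vs. vs \<noteq> [] \<and> distinct vs \<and> hd vs = u \<and> last vs = v
           \<and> (\<forall>i. Suc i < length vs \<longrightarrow> {vs ! i, vs ! Suc i} \<in> F)"
  using assms
proof (induction rule: rtrancl_induct)
  case base
  then show ?case by (intro exI[of _ "[u]"]) auto
next
  case (step v w)
  then obtain vs where vs: "vs \<noteq> []" "distinct vs" "hd vs = u" "last vs = v"
    "\<forall>i. Suc i < length vs \<longrightarrow> {vs ! i, vs ! Suc i} \<in> F" by blast
  show ?case
  proof (cases "w \<in> set vs")
    case True
    then obtain j where j: "j < length vs" "vs ! j = w" by (auto simp: in_set_conv_nth)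
    then show ?thesis
      using vs by (intro exI[of _ "take (Suc j) vs"]) (auto simp: last_conv_nth hd_conv_nth)
  next
    case False
    have "{(vs @ [w]) ! i, (vs @ [w]) ! Suc i} \<in> F" if "Suc i < length (vs @ [w])" for i
    proof (cases "Suc i < length vs")
      case True
      then show ?thesis using vs(5) by (auto simp: nth_append)
    next
      case False
      then have i: "i = length vs - 1" "Suc i = length vs" using that vs(1) by auto
      have "vs ! i = v" using vs(1,4) i by (simp add: last_conv_nth)
      then show ?thesis using i step.hyps(2) by (auto simp: nth_append adj_def)
    qed
    then show ?thesis
      using vs False by (intro exI[of _ "vs @ [w]"]) auto
  qed
qed

text \<open>
  A simple path from \<open>u\<close> to \<open>v\<close> has at least three vertices because \<open>{u, v}\<close> is not in \<open>F\<close>, and the new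
  edge closes it to a cycle.
\<close>

lemma cycle_if_connected:
  assumes "(u, v) \<in> (adj F)\<^sup>*" "u \<noteq> v" "{u, v} \<notin> F"
  shows "\<not> acyclic_edges (insert {u, v} F)"
proof -
  obtain vs where vs: "vs \<noteq> []" "distinct vs" "hd vs = u" "last vs = v"
    "\<forall>i. Suc i < length vs \<longrightarrow> {vs ! i, vs ! Suc i} \<in> F"
    using rtrancl_adj_path[OF assms(1)] by blast
  have ends: "vs ! 0 = u" "vs ! (length vs - 1) = v"
    using vs by (auto simp: hd_conv_nth last_conv_nth)
  have "length vs \<noteq> 1" using ends assms(2) by auto
  moreover have "length vs \<noteq> 2"
  proof
    assume "length vs = 2"
    then have "{u, v} \<in> F" using vs(5)[rule_format, of 0] ends by auto
    with assms(3) show False by simp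
  qed
  moreover have "length vs \<noteq> 0" using vs(1) by simp
  ultimately have len: "length vs \<ge> 3" by linarith
  have "{vs ! i, vs ! (Suc i mod length vs)} \<in> insert {u, v} F" if "i < length vs" for i
  proof (cases "Suc i < length vs")
    case True
    then show ?thesis using vs(5) by simp
  next
    case False
    then have "Suc i = length vs" using that by simp
    then have "i = length vs - 1" "Suc i mod length vs = 0" by auto
    then show ?thesis using ends by (simp add: insert_commute)
  qed
  then have "is_cycle (insert {u, v} F) vs"
    using vs(2) len by (simp add: is_cycle_def)
  then show ?thesis by (auto simp: acyclic_edges_def)
qed

text \<open>
  The cycle must use \<open>{u, v}\<close>, and exactly once; the rest of it is a walk in \<open>F\<close> from one end to the
  other.
\<close>

lemma connected_if_cycle:
  assumes "acyclic_edges F" "\<not> acyclic_edges (insert {u, v} F)"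
  shows "(u, v) \<in> (adj F)\<^sup>*"
proof -
  obtain vs where vs: "is_cycle (insert {u, v} F) vs"
    using assms(2) by (auto simp: acyclic_edges_def)
  define n where "n = length vs"
  have n: "n \<ge> 3" and dist: "distinct vs"
    and edge: "\<And>i. i < n \<Longrightarrow> {vs ! i, vs ! (Suc i mod n)} \<in> insert {u, v} F"
    using vs by (auto simp: is_cycle_def n_def)
  have "\<not> is_cycle F vs" using assms(1) by (auto simp: acyclic_edges_def)
  then obtain i where i: "i < n" "{vs ! i, vs ! (Suc i mod n)} \<notin> F"
    using n dist by (auto simp: is_cycle_def n_def)
  then have uv: "{vs ! i, vs ! (Suc i mod n)} = {u, v}" using edge by blast
  have other: "{vs ! j, vs ! (Suc j mod n)} \<in> F" if j: "j < n" "j \<noteq> i" for j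
  proof (rule ccontr)
    assume "{vs ! j, vs ! (Suc j mod n)} \<notin> F"
    then have "{vs ! j, vs ! (Suc j mod n)} = {vs ! i, vs ! (Suc i mod n)}"
      using edge[OF j(1)] uv by blast
    then have "vs ! j = vs ! (Suc i mod n)" "vs ! (Suc j mod n) = vs ! i"
      using j i(1) dist by (auto simp: doubleton_eq_iff n_def nth_eq_iff_index_eq)
    moreover have "Suc i mod n < length vs" "Suc j mod n < length vs" "i < length vs" "j < length vs"
      using n i(1) j(1) by (simp_all flip: n_def)
    ultimately have "j = Suc i mod n" "Suc j mod n = i"
      using nth_eq_iff_index_eq[OF dist] by blast+
    then show False using n i(1) by (auto simp: mod_Suc split: if_splits)
  qed
  have walk: "(vs ! (Suc i mod n), vs ! ((Suc i + k) mod n)) \<in> (adj F)\<^sup>*" if "k < n" for k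
    using that
  proof (induction k)
    case (Suc k)
    have "(Suc i + k) mod n \<noteq> i"
    proof
      assume eq: "(Suc i + k) mod n = i"
      show False
      proof (cases "Suc i + k < n")
        case False
        then have "(Suc i + k) mod n = Suc i + k - n"
          using Suc.prems i(1) by (simp add: le_mod_geq)
        then show False using eq Suc.prems by simp
      qed (use eq in simp)
    qed
    then have "{vs ! ((Suc i + k) mod n), vs ! (Suc ((Suc i + k) mod n) mod n)} \<in> F"
      using other n by simp
    then have "(vs ! ((Suc i + k) mod n), vs ! ((Suc i + Suc k) mod n)) \<in> adj F"
      by (simp add: adj_def mod_Suc_eq)
    with Suc show ?case by (simp add: rtrancl.rtrancl_into_rtrancl)
  qed simp
  have "(vs ! (Suc i mod n), vs ! i) \<in> (adj F)\<^sup>*"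
    using walk[of "n - 1"] n i(1) by (simp add: add.commute)
  then show ?thesis
    using uv adj_rtrancl_sym[of "vs ! (Suc i mod n)" "vs ! i" F] by (auto simp: doubleton_eq_iff)
qed

lemma acyclic_edges_mono: "acyclic_edges F \<Longrightarrow> F' \<subseteq> F \<Longrightarrow> acyclic_edges F'"
  by (fastforce simp: acyclic_edges_def is_cycle_def)

lemma finite_maximal_set:
  assumes "finite {W. Q W}" "Q W0"
  obtains W where "Q W" "\<And>W'. Q W' \<Longrightarrow> W \<subseteq> W' \<Longrightarrow> W' = W"
proof -
  have "{W. Q W} \<noteq> {}" using assms(2) by blast
  from finite_has_maximal[OF assms(1) this] obtain W
    where "Q W" "\<forall>W'\<in>{W. Q W}. W \<subseteq> W' \<longrightarrow> W = W'" by auto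
  then show thesis by (intro that[of W]) auto
qed

lemma finite_minimal_set:
  assumes "finite {W. Q W}" "Q W0"
  obtains W where "Q W" "\<And>W'. Q W' \<Longrightarrow> W' \<subseteq> W \<Longrightarrow> W' = W"
proof -
  have "{W. Q W} \<noteq> {}" using assms(2) by blast
  from finite_has_minimal[OF assms(1) this] obtain W
    where "Q W" "\<forall>W'\<in>{W. Q W}. W' \<subseteq> W \<longrightarrow> W = W'" by auto
  then show thesis by (intro that[of W]) auto
qed

lemma bases_graphic_matroid:
  "B \<in> bases (graphic_matroid G) \<longleftrightarrow> B \<subseteq> edges G \<and> acyclic_edges B
     \<and> (\<forall>J. J \<subseteq> edges G \<longrightarrow> acyclic_edges J \<longrightarrow> B \<subseteq> J \<longrightarrow> J = B)"
  by (auto simp: bases_def graphic_matroid_def)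

text \<open>
  An edge of \<open>F\<close> that \<open>B\<close> lacks closes a cycle with \<open>B\<close>, so \<open>B\<close> joins its ends already.
\<close>

lemma maximal_acyclic_connects:
  assumes "connects F V" "acyclic_edges B"
    and "\<And>e. e \<in> F - B \<Longrightarrow> \<not> acyclic_edges (insert e B)"
  shows "connects B V"
proof (rule connects_if_steps_connected[OF assms(1)])
  fix x y assume "{x, y} \<in> F"
  then show "(x, y) \<in> (adj B)\<^sup>*"
    using connected_if_cycle[OF assms(2)] assms(3)[of "{x, y}"]
    by (cases "{x, y} \<in> B") (auto simp: adj_def)
qed

lemma basis_connects:
  assumes "connected_graph G" "B \<in> bases (graphic_matroid G)"
  shows "connects B (verts G)"
proof (rule maximal_acyclic_connects)
  show "connects (edges G) (verts G)" using assms(1) by (simp add: connected_graph_iff)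
  show "acyclic_edges B" using assms(2) by (simp add: bases_graphic_matroid)
  show "\<not> acyclic_edges (insert e B)" if "e \<in> edges G - B" for e
    using assms(2) that unfolding bases_graphic_matroid by blast
qed

lemma finite_edges: "simple_graph G \<Longrightarrow> finite (edges G)"
  by (rule finite_subset[of _ "Pow (verts G)"]) (auto simp: simple_graph_def)

text \<open>
  A maximal acyclic subset of \<open>F\<close> is still connecting, and so it is maximal among all acyclic
  sets of edges of \<open>G\<close>.
\<close>

lemma connecting_set_contains_basis:
  assumes G: "simple_graph G" and F: "F \<subseteq> edges G" and conn: "connects F (verts G)"
  shows "\<exists>B\<in>bases (graphic_matroid G). B \<subseteq> F"
proof -
  have "finite {B. B \<subseteq> F \<and> acyclic_edges B}"
    using finite_subset[OF F finite_edges[OF G]] by simp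
  moreover have "{} \<subseteq> F \<and> acyclic_edges {}"
    by (auto simp: acyclic_edges_def is_cycle_def intro!: exI[of _ 0])
  ultimately obtain B where B: "B \<subseteq> F \<and> acyclic_edges B"
    and max: "\<And>B'. B' \<subseteq> F \<and> acyclic_edges B' \<Longrightarrow> B \<subseteq> B' \<Longrightarrow> B' = B"
    by (rule finite_maximal_set) blast
  have connB: "connects B (verts G)"
  proof (rule maximal_acyclic_connects[OF conn])
    show "acyclic_edges B" using B by simp
    show "\<not> acyclic_edges (insert e B)" if "e \<in> F - B" for e
      using max[of "insert e B"] B that by blast
  qed
  have "J = B" if J: "J \<subseteq> edges G" "acyclic_edges J" "B \<subseteq> J" for J
  proof (rule ccontr)
    assume "J \<noteq> B"
    then obtain e where e: "e \<in> J" "e \<notin> B" using J(3) by blast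
    then have "e \<subseteq> verts G" "card e = 2" using J(1) G by (auto simp: simple_graph_def)
    then obtain u v where uv: "e = {u, v}" "u \<noteq> v" "u \<in> verts G" "v \<in> verts G"
      by (auto simp: card_2_iff)
    then have "\<not> acyclic_edges (insert e B)"
      using connB e(2) cycle_if_connected[of u v B] by (auto simp: connects_def)
    moreover have "insert e B \<subseteq> J" using e(1) J(3) by blast
    ultimately show False using acyclic_edges_mono J(2) by blast
  qed
  then have "B \<in> bases (graphic_matroid G)"
    using B F by (auto simp: bases_graphic_matroid)
  then show ?thesis using B by blast
qed

text \<open>
  Contracting the fibres of \<open>\<phi>\<close> turns \<open>B\<close> into the edge set of a connected graph on \<open>X\<close>, which has at
  least \<open>card X - 1\<close> edges apart from loops. The edges are collected one at a time, each leading
  to a new vertex of \<open>X\<close>.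
\<close>

lemma card_quotient_le_crossing_edges:
  assumes conn: "connects B V" and "V \<noteq> {}" and BV: "\<And>e. e \<in> B \<Longrightarrow> e \<subseteq> V"
    and "finite B" and "finite X" and phi: "\<phi> ` V = X"
  shows "card X \<le> Suc (card {e \<in> B. card (\<phi> ` e) = 2})"
proof -
  have "\<exists>Y D. Y \<subseteq> X \<and> card Y = Suc k \<and> D \<subseteq> B \<and> card D = k \<and> (\<forall>e\<in>D. card (\<phi> ` e) = 2 \<and> \<phi> ` e \<subseteq> Y)"
    if "k < card X" for k
    using that
  proof (induction k)
    case 0
    obtain v where "v \<in> V" using \<open>V \<noteq> {}\<close> by blast
    then show ?case using phi by (intro exI[of _ "{\<phi> v}"] exI[of _ "{}"]) auto
  next
    case (Suc k)
    then obtain Y D where Y: "Y \<subseteq> X" "card Y = Suc k"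
      and D: "D \<subseteq> B" "card D = k" "\<forall>e\<in>D. card (\<phi> ` e) = 2 \<and> \<phi> ` e \<subseteq> Y" by auto
    have "Y \<noteq> {}" using Y(2) by auto
    moreover have "Y \<noteq> X" using Y(2) Suc.prems by auto
    ultimately obtain u v where uv: "u \<in> V" "\<phi> u \<in> Y" "v \<in> V" "\<phi> v \<notin> Y"
      using Y(1) phi by blast
    have "(u, v) \<in> (adj B)\<^sup>*" using conn uv by (simp add: connects_def)
    then obtain x y where xy: "{x, y} \<in> B" "\<phi> x \<in> Y" "\<phi> y \<notin> Y"
      using rtrancl_crosses[of u v "adj B" "{w. \<phi> w \<in> Y}"] uv by (auto simp: adj_def)
    have finY: "finite Y" and finD: "finite D"
      using Y(1) D(1) assms finite_subset by blast+
    have "{x, y} \<notin> D" using D(3) xy by auto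
    moreover have "\<phi> y \<in> X" using BV[OF xy(1)] phi by auto
    moreover have "card {\<phi> x, \<phi> y} = 2" using xy by (cases "\<phi> x = \<phi> y") auto
    moreover from this have "\<forall>e\<in>insert {x, y} D. card (\<phi> ` e) = 2 \<and> \<phi> ` e \<subseteq> insert (\<phi> y) Y"
      using D(3) xy(2) by (simp, blast)
    ultimately show ?case
      using xy Y D(1,2) finY finD
      by (intro exI[of _ "insert (\<phi> y) Y"] exI[of _ "insert {x, y} D"]) simp
  qed
  from this[of "card X - 1"] show ?thesis
  proof (cases "card X = 0")
    case False
    then obtain Y D where D: "D \<subseteq> B" "card D = card X - 1" "\<forall>e\<in>D. card (\<phi> ` e) = 2"
      using \<open>card X - 1 < card X \<Longrightarrow> _\<close> by force
    have "card D \<le> card {e \<in> B. card (\<phi> ` e) = 2}"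
      using D \<open>finite B\<close> by (intro card_mono) auto
    then show ?thesis using D(2) by linarith
  qed simp
qed

text \<open>
  The fibres of \<open>\<phi>\<close> are the blocks of a partition of the vertices of \<open>G\<close> into connected parts, with one
  vertex of \<open>U\<close> each. They are grown from the singletons in \<open>U\<close>, a vertex at a time. The edges whose
  image under \<open>\<phi>\<close> is a singleton are those inside a block.
\<close>

lemma connected_retraction:
  assumes G: "simple_graph G" "connected_graph G" and U: "U \<subseteq> verts G" "U \<noteq> {}"
  shows "\<exists>\<phi>. (\<forall>u\<in>U. \<phi> u = u) \<and> \<phi> ` verts G \<subseteq> U
           \<and> (\<forall>v\<in>verts G. (v, \<phi> v) \<in> (adj {e \<in> edges G. card (\<phi> ` e) = 1})\<^sup>*)"
proof -
  define P where "P W \<longleftrightarrow> (\<exists>\<phi>. (\<forall>u\<in>U. \<phi> u = u) \<and> \<phi> ` W \<subseteq> U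
      \<and> (\<forall>v\<in>W. (v, \<phi> v) \<in> (adj {e \<in> edges G. e \<subseteq> W \<and> card (\<phi> ` e) = 1})\<^sup>*))" for W
  let ?Q = "\<lambda>W. U \<subseteq> W \<and> W \<subseteq> verts G \<and> P W"
  have fin: "finite (verts G)" using G by (simp add: simple_graph_def)
  have "finite {W. ?Q W}" using fin by simp
  moreover have "?Q U" using U by (auto simp: P_def intro!: exI[of _ id])
  ultimately obtain W where W: "?Q W" and max: "\<And>W'. ?Q W' \<Longrightarrow> W \<subseteq> W' \<Longrightarrow> W' = W"
    by (rule finite_maximal_set) blast
  have "W = verts G"
  proof (rule ccontr)
    assume "W \<noteq> verts G"
    then obtain u v where uv: "u \<in> W" "v \<in> verts G" "v \<notin> W" using W U by blast
    have "u \<in> verts G" using uv W by blast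
    then have "(u, v) \<in> (adj (edges G))\<^sup>*" using uv G(2) by (simp add: connected_graph_iff connects_def)
    then obtain x y where xy: "{x, y} \<in> edges G" "x \<in> W" "y \<notin> W"
      using rtrancl_crosses[of u v "adj (edges G)" W] uv by (auto simp: adj_def)
    obtain \<phi> where \<phi>: "\<forall>u\<in>U. \<phi> u = u" "\<phi> ` W \<subseteq> U"
      "\<forall>v\<in>W. (v, \<phi> v) \<in> (adj {e \<in> edges G. e \<subseteq> W \<and> card (\<phi> ` e) = 1})\<^sup>*"
      using W by (auto simp: P_def)
    define \<psi> where "\<psi> = \<phi>(y := \<phi> x)"
    have agree: "\<psi> v = \<phi> v" if "v \<in> W" for v using that xy by (auto simp: \<psi>_def)
    let ?F = "{e \<in> edges G. e \<subseteq> W \<and> card (\<phi> ` e) = 1}"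
    let ?F' = "{e \<in> edges G. e \<subseteq> insert y W \<and> card (\<psi> ` e) = 1}"
    have "\<psi> ` e = \<phi> ` e" if "e \<subseteq> W" for e using that agree by (auto intro!: image_cong)
    then have "?F \<subseteq> ?F'" by auto
    then have mono: "(adj ?F)\<^sup>* \<subseteq> (adj ?F')\<^sup>*" by (intro rtrancl_mono) (auto simp: adj_def)
    have "\<psi> ` {y, x} = {\<phi> x}" using xy by (auto simp: \<psi>_def)
    then have "{y, x} \<in> ?F'" using xy by (simp add: insert_commute)
    then have "(y, x) \<in> adj ?F'" by (simp add: adj_def)
    moreover have "(x, \<phi> x) \<in> (adj ?F')\<^sup>*" using \<phi>(3) xy(2) mono by blast
    ultimately have "(y, \<psi> y) \<in> (adj ?F')\<^sup>*" by (simp add: \<psi>_def converse_rtrancl_into_rtrancl)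
    moreover have "(v, \<psi> v) \<in> (adj ?F')\<^sup>*" if "v \<in> W" for v
      using \<phi>(3) that mono agree by auto
    moreover have "\<forall>u\<in>U. \<psi> u = u" using \<phi>(1) agree W by auto
    moreover have "\<psi> ` insert y W \<subseteq> U" using \<phi>(2) xy(2) agree by (auto simp: \<psi>_def)
    ultimately have "P (insert y W)" unfolding P_def by (intro exI[of _ \<psi>]) blast
    moreover have "y \<in> verts G" using xy(1) G(1) by (auto simp: simple_graph_def)
    ultimately have "?Q (insert y W)" using W by auto
    then have "insert y W = W" using max by blast
    then show False using xy(3) by blast
  qed
  then obtain \<phi> where "\<forall>u\<in>U. \<phi> u = u" "\<phi> ` verts G \<subseteq> U"
    "\<forall>v\<in>verts G. (v, \<phi> v) \<in> (adj {e \<in> edges G. e \<subseteq> verts G \<and> card (\<phi> ` e) = 1})\<^sup>*"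
    using W by (auto simp: P_def)
  moreover have "{e \<in> edges G. e \<subseteq> verts G \<and> card (\<phi> ` e) = 1} = {e \<in> edges G. card (\<phi> ` e) = 1}"
    using G(1) by (auto simp: simple_graph_def)
  ultimately show ?thesis by auto
qed

section \<open>Packing arborescences\<close>

definition in_cut :: "('v \<times> 'v \<Rightarrow> nat) \<Rightarrow> 'v set \<Rightarrow> 'v set \<Rightarrow> nat" where
  "in_cut c V S = sum c ((V - S) \<times> S)"

lemma in_cut_submodular:
  assumes "finite V" "A \<subseteq> V" "B \<subseteq> V"
  shows "in_cut c V (A \<inter> B) + in_cut c V (A \<union> B) \<le> in_cut c V A + in_cut c V B"
proof -
  have *: "in_cut c V S = (\<Sum>(x, y)\<in>V \<times> V. if x \<notin> S \<and> y \<in> S then c (x, y) else 0)"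
    if "S \<subseteq> V" for S
    unfolding in_cut_def using assms(1) that
    by (intro sum.mono_neutral_cong_left) (auto split: if_splits)
  have AB: "A \<inter> B \<subseteq> V" "A \<union> B \<subseteq> V" using assms by auto
  show ?thesis
    unfolding *[OF AB(1)] *[OF AB(2)] *[OF assms(2)] *[OF assms(3)] sum.distrib[symmetric]
    by (intro sum_mono) auto
qed

text \<open>
  Lovasz' argument. An arborescence \<open>A\<close> on a vertex set \<open>U\<close> containing \<open>r\<close> is grown arc by arc, such
  that removing it leaves every in-cut at least \<open>k\<close>. An arc \<open>(x, y)\<close> leaving \<open>U\<close> may be added unless it
  enters a tight set, one whose remaining in-cut is exactly \<open>k\<close>. By submodularity, intersecting
  tight sets have tight intersections. If all tight sets are contained in \<open>U\<close>, any arc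
  leaving \<open>U\<close> will do. Otherwise choose a minimal tight set \<open>T\<close> that is not contained in \<open>U\<close>.
  Since \<open>A\<close> has no arc into \<open>T - U\<close>, the in-cut of \<open>T - U\<close> is still larger than that of \<open>T\<close>, so there is
  an arc from \<open>T \<inter> U\<close> to \<open>T - U\<close>. A tight set that this arc enters would meet \<open>T\<close> in a smaller tight
  set.
\<close>

lemma arborescence_exists:
  fixes c :: "'v \<times> 'v \<Rightarrow> nat"
  assumes "finite V" "r \<in> V"
    and cut: "\<And>S. S \<subseteq> V - {r} \<Longrightarrow> S \<noteq> {} \<Longrightarrow> Suc k \<le> in_cut c V S"
  shows "\<exists>A \<subseteq> V \<times> V. (\<forall>v\<in>V. (r, v) \<in> A\<^sup>*) \<and> (\<forall>p\<in>A. 1 \<le> c p)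
           \<and> (\<forall>S \<subseteq> V - {r}. S \<noteq> {} \<longrightarrow> k \<le> in_cut (\<lambda>p. c p - of_bool (p \<in> A)) V S)"
proof -
  define P where "P U A \<longleftrightarrow> r \<in> U \<and> U \<subseteq> V \<and> A \<subseteq> U \<times> U \<and> (\<forall>v\<in>U. (r, v) \<in> A\<^sup>*) \<and> (\<forall>p\<in>A. 1 \<le> c p)
      \<and> (\<forall>S \<subseteq> V - {r}. S \<noteq> {} \<longrightarrow> k \<le> in_cut (\<lambda>p. c p - of_bool (p \<in> A)) V S)" for U A
  have "{U. \<exists>A. P U A} \<subseteq> Pow V" by (auto simp: P_def)
  then have "finite {U. \<exists>A. P U A}" using assms(1) finite_subset by blast
  moreover have "\<exists>A. P {r} A"
  proof -
    have "k \<le> in_cut c V S" if "S \<subseteq> V - {r}" "S \<noteq> {}" for S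
      using cut[OF that] by simp
    then have "P {r} {}" using assms(2) by (auto simp: P_def)
    then show ?thesis by blast
  qed
  ultimately obtain U where "\<exists>A. P U A" and max: "\<And>U'. \<exists>A. P U' A \<Longrightarrow> U \<subseteq> U' \<Longrightarrow> U' = U"
    by (rule finite_maximal_set) blast
  then obtain A where PA: "P U A" by blast
  then have U: "r \<in> U" "U \<subseteq> V" and A: "A \<subseteq> U \<times> U" "\<forall>v\<in>U. (r, v) \<in> A\<^sup>*" "\<forall>p\<in>A. 1 \<le> c p"
    by (auto simp: P_def)
  define c' where "c' p = c p - of_bool (p \<in> A)" for p
  have cut': "k \<le> in_cut c' V S" if "S \<subseteq> V - {r}" "S \<noteq> {}" for S
    using PA that unfolding P_def c'_def by blast
  have cut_outside: "Suc k \<le> in_cut c' V S" if "S \<subseteq> V - U" "S \<noteq> {}" for S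
  proof -
    have "in_cut c' V S = in_cut c V S"
      unfolding in_cut_def using that A(1) by (intro sum.cong) (auto simp: c'_def)
    moreover have "S \<subseteq> V - {r}" using that U by blast
    ultimately show ?thesis using cut[of S] that(2) by simp
  qed
  have "U = V"
  proof (rule ccontr)
    assume "U \<noteq> V"
    then have VU: "V - U \<noteq> {}" using U by blast
    have "\<exists>x y. x \<in> U \<and> y \<in> V - U \<and> 1 \<le> c' (x, y)
        \<and> (\<forall>S \<subseteq> V - {r}. x \<notin> S \<longrightarrow> y \<in> S \<longrightarrow> Suc k \<le> in_cut c' V S)"
    proof (cases "\<exists>S. S \<subseteq> V - {r} \<and> S - U \<noteq> {} \<and> in_cut c' V S = k")
      case False
      have "sum c' ((V - (V - U)) \<times> (V - U)) \<noteq> 0"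
        using cut_outside[of "V - U"] VU by (simp add: in_cut_def)
      then obtain p where "p \<in> (V - (V - U)) \<times> (V - U)" "c' p \<noteq> 0"
        by (meson sum.neutral)
      then have "fst p \<in> U" "snd p \<in> V - U" "1 \<le> c' (fst p, snd p)" by auto
      then obtain x y where xy: "x \<in> U" "y \<in> V - U" "1 \<le> c' (x, y)" by blast
      have "Suc k \<le> in_cut c' V S" if "S \<subseteq> V - {r}" "y \<in> S" for S
      proof -
        have "in_cut c' V S \<noteq> k" using False that xy by blast
        moreover have "k \<le> in_cut c' V S" using cut' that by blast
        ultimately show ?thesis by simp
      qed
      with xy show ?thesis by blast
    next
      case True
      let ?C = "\<lambda>S. S \<subseteq> V - {r} \<and> S - U \<noteq> {} \<and> in_cut c' V S = k"
      have "{S. ?C S} \<subseteq> Pow V" by auto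
      then have "finite {S. ?C S}" using assms(1) finite_subset by blast
      moreover obtain S0 where "?C S0" using True by blast
      ultimately obtain T where T: "?C T" and min: "\<And>S. ?C S \<Longrightarrow> S \<subseteq> T \<Longrightarrow> S = T"
        by (rule finite_minimal_set) blast
      have finT: "finite T" using T assms(1) finite_subset by blast
      have "\<exists>x\<in>T \<inter> U. \<exists>y\<in>T - U. c' (x, y) \<noteq> 0"
      proof (rule ccontr)
        assume none: "\<not> ?thesis"
        have "in_cut c' V (T - U) = sum c' ((V - T) \<times> (T - U))"
          unfolding in_cut_def using assms(1) finT none
          by (intro sum.mono_neutral_right) auto
        also have "\<dots> \<le> in_cut c' V T"
          unfolding in_cut_def using assms(1) finT by (intro sum_mono2) auto
        finally show False using cut_outside[of "T - U"] T by auto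
      qed
      then obtain x y where xy: "x \<in> T \<inter> U" "y \<in> T - U" "c' (x, y) \<noteq> 0" by blast
      have "Suc k \<le> in_cut c' V S" if S: "S \<subseteq> V - {r}" "x \<notin> S" "y \<in> S" for S
      proof (rule ccontr)
        assume "\<not> Suc k \<le> in_cut c' V S"
        then have "in_cut c' V S \<le> k" by simp
        moreover have "in_cut c' V T = k" using T by simp
        moreover have "in_cut c' V (T \<inter> S) + in_cut c' V (T \<union> S) \<le> in_cut c' V T + in_cut c' V S"
          using T S by (intro in_cut_submodular[OF assms(1)]) auto
        moreover have "k \<le> in_cut c' V (T \<inter> S)" "k \<le> in_cut c' V (T \<union> S)"
          using T S xy by (intro cut'; auto)+
        ultimately have "in_cut c' V (T \<inter> S) = k" by linarith
        then have "?C (T \<inter> S)" using T S xy by auto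
        then have "T \<inter> S = T" using min by blast
        then show False using xy S by blast
      qed
      moreover have "x \<in> U" "y \<in> V - U" "1 \<le> c' (x, y)" using xy T by auto
      ultimately show ?thesis by blast
    qed
    then obtain x y where xy: "x \<in> U" "y \<in> V - U" "1 \<le> c' (x, y)"
      and safe: "\<And>S. S \<subseteq> V - {r} \<Longrightarrow> x \<notin> S \<Longrightarrow> y \<in> S \<Longrightarrow> Suc k \<le> in_cut c' V S"
      by blast
    define A' where "A' = insert (x, y) A"
    have new: "(x, y) \<notin> A" using xy A(1) by blast
    have "k \<le> in_cut (\<lambda>p. c p - of_bool (p \<in> A')) V S" if S: "S \<subseteq> V - {r}" "S \<noteq> {}" for S
    proof (cases "x \<notin> S \<and> y \<in> S")
      case True
      have fin: "finite ((V - S) \<times> S)" using S assms(1) finite_subset by blast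
      have mem: "(x, y) \<in> (V - S) \<times> S" using True xy U by auto
      have "in_cut c' V S = c' (x, y) + sum c' ((V - S) \<times> S - {(x, y)})"
        unfolding in_cut_def by (rule sum.remove[OF fin mem])
      also have "sum c' ((V - S) \<times> S - {(x, y)}) = sum (\<lambda>p. c p - of_bool (p \<in> A')) ((V - S) \<times> S - {(x, y)})"
        by (intro sum.cong) (auto simp: c'_def A'_def)
      also have "c' (x, y) = Suc (c (x, y) - of_bool ((x, y) \<in> A'))"
        using xy new by (auto simp: c'_def A'_def)
      finally have "in_cut c' V S = Suc (in_cut (\<lambda>p. c p - of_bool (p \<in> A')) V S)"
        unfolding in_cut_def by (simp add: sum.remove[OF fin mem])
      then show ?thesis using safe[OF S(1)] True by simp
    next
      case False
      have "in_cut (\<lambda>p. c p - of_bool (p \<in> A')) V S = in_cut c' V S"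
        unfolding in_cut_def using False by (intro sum.cong) (auto simp: c'_def A'_def)
      then show ?thesis using cut'[OF S] by simp
    qed
    moreover have "(r, v) \<in> A'\<^sup>*" if "v \<in> insert y U" for v
    proof -
      have "A\<^sup>* \<subseteq> A'\<^sup>*" by (rule rtrancl_mono) (auto simp: A'_def)
      then have reach: "(r, w) \<in> A'\<^sup>*" if "w \<in> U" for w using A(2) that by blast
      have "(x, y) \<in> A'" by (simp add: A'_def)
      with reach[OF xy(1)] have "(r, y) \<in> A'\<^sup>*" by (rule rtrancl_into_rtrancl)
      with reach that show ?thesis by blast
    qed
    moreover have "1 \<le> c (x, y)" using xy(3) by (simp add: c'_def)
    ultimately have "P (insert y U) A'"
      using U A xy unfolding P_def by (auto simp: A'_def)
    then have "insert y U = U" using max by blast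
    then show False using xy(2) by blast
  qed
  then show ?thesis using PA unfolding P_def by blast
qed

text \<open>
  Edmonds' theorem on disjoint arborescences. Only that each \<open>A i\<close> reaches all vertices is recorded:
  superfluous arcs are discarded when a spanning tree is extracted.
\<close>

theorem arborescence_packing:
  fixes c :: "'v \<times> 'v \<Rightarrow> nat"
  assumes "finite V" "r \<in> V"
    and "\<And>S. S \<subseteq> V - {r} \<Longrightarrow> S \<noteq> {} \<Longrightarrow> k \<le> in_cut c V S"
  shows "\<exists>A. (\<forall>i<k. A i \<subseteq> V \<times> V \<and> (\<forall>v\<in>V. (r, v) \<in> (A i)\<^sup>*))
           \<and> (\<forall>p. (\<Sum>i<k. of_bool (p \<in> A i)) \<le> c p)"
  using assms(3)
proof (induction k arbitrary: c)
  case 0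
  then show ?case by simp
next
  case (Suc k)
  obtain A0 where A0: "A0 \<subseteq> V \<times> V" "\<forall>v\<in>V. (r, v) \<in> A0\<^sup>*" "\<forall>p\<in>A0. 1 \<le> c p"
    "\<forall>S \<subseteq> V - {r}. S \<noteq> {} \<longrightarrow> k \<le> in_cut (\<lambda>p. c p - of_bool (p \<in> A0)) V S"
    using arborescence_exists[OF assms(1,2) Suc.prems] by blast
  then obtain A where A: "\<forall>i<k. A i \<subseteq> V \<times> V \<and> (\<forall>v\<in>V. (r, v) \<in> (A i)\<^sup>*)"
    "\<forall>p. (\<Sum>i<k. of_bool (p \<in> A i)) \<le> c p - of_bool (p \<in> A0)"
    using Suc.IH[of "\<lambda>p. c p - of_bool (p \<in> A0)"] by auto
  have "(\<Sum>i<Suc k. of_bool (p \<in> (A(k := A0)) i)) \<le> c p" for p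
  proof -
    have "(\<Sum>i<Suc k. of_bool (p \<in> (A(k := A0)) i)) = (\<Sum>i<k. of_bool (p \<in> A i)) + (of_bool (p \<in> A0) :: nat)"
      by simp
    also have "\<dots> \<le> (c p - of_bool (p \<in> A0)) + of_bool (p \<in> A0)"
      using A(2)[rule_format, of p] by linarith
    also have "\<dots> \<le> c p" using A0(3) by auto
    finally show ?thesis .
  qed
  then show ?case
    using A(1) A0(1,2) by (intro exI[of _ "A(k := A0)"]) (auto simp: less_Suc_eq)
qed

section \<open>The Waldschmidt constant as a limit\<close>

text \<open>
  Fekete's lemma; the limit is the infimum.
\<close>

lemma subadditive_ratio_convergent:
  fixes a :: "nat \<Rightarrow> nat"
  assumes sub: "\<And>m n. a (m + n) \<le> a m + a n"
  shows "convergent (\<lambda>n. real (a n) / real n)"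
proof -
  define L where "L = Inf ((\<lambda>n. real (a n) / real n) ` {1..})"
  have bdd: "bdd_below ((\<lambda>n. real (a n) / real n) ` {1..})"
    by (rule bdd_belowI[of _ 0]) auto
  have "(\<lambda>n. real (a n) / real n) \<longlonglongrightarrow> L"
  proof (rule order_tendstoI)
    fix l assume "l < L"
    have "l < real (a n) / real n" if "n \<ge> 1" for n
    proof -
      have "L \<le> real (a n) / real n"
        unfolding L_def using that by (intro cInf_lower[OF _ bdd]) auto
      with \<open>l < L\<close> show ?thesis by simp
    qed
    then show "\<forall>\<^sub>F n in sequentially. l < real (a n) / real n"
      unfolding eventually_sequentially by blast
  next
    fix u assume "L < u"
    then obtain N where N: "N \<ge> 1" "real (a N) / real N < u"
      using cInf_lessD[of "(\<lambda>n. real (a n) / real n) ` {1..}" u] by (auto simp: L_def)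
    define M where "M = (\<Sum>j<N. a j)"
    have mult: "a (q * N + j) \<le> q * a N + a j" for q j
    proof (induction q)
      case (Suc q)
      have "a (Suc q * N + j) \<le> a N + a (q * N + j)"
        using sub[of N "q * N + j"] by (simp add: add.assoc)
      with Suc show ?case by simp
    qed simp
    have bound: "real (a n) / real n \<le> real (a N) / real N + real M / real n" if "n \<ge> 1" for n
    proof -
      have "a (n mod N) \<le> M"
        unfolding M_def using N(1) by (intro member_le_sum) auto
      then have "a n \<le> (n div N) * a N + M"
        using mult[of "n div N" "n mod N"] by simp
      then have "real (a n) \<le> real (n div N) * real (a N) + real M"
        by (metis of_nat_add of_nat_le_iff of_nat_mult)
      also have "real (n div N) \<le> real n / real N" by (rule of_nat_div_le_of_nat)
      finally have "real (a n) \<le> real n / real N * real (a N) + real M"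
        by (simp add: mult_right_mono)
      then have "real (a n) / real n \<le> (real n / real N * real (a N) + real M) / real n"
        by (rule divide_right_mono) simp
      also have "\<dots> = real (a N) / real N + real M / real n"
        using that by (simp add: add_divide_distrib)
      finally show ?thesis .
    qed
    have "(\<lambda>n. real M / real n) \<longlonglongrightarrow> 0" by (rule lim_const_over_n)
    then have "\<forall>\<^sub>F n in sequentially. real M / real n < u - real (a N) / real N"
      using N(2) by (intro order_tendstoD(2)) auto
    then show "\<forall>\<^sub>F n in sequentially. real (a n) / real n < u"
      using eventually_ge_at_top[of 1]
    proof eventually_elim
      case (elim n)
      then show ?case using bound[of n] by linarith
    qed
  qed
  then show ?thesis by (rule convergentI)
qed

lemma monom_degree_eq_deg_on:
  assumes "finite E" "a \<in> exponents E" shows "monom_degree a = deg_on E a"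
  unfolding monom_degree_def deg_on_def using assms
  by (intro sum.mono_neutral_left) (auto simp: exponents_def in_keys_iff)

definition symbolic_degree :: "'e set \<Rightarrow> 'e set set \<Rightarrow> nat \<Rightarrow> nat" where
  "symbolic_degree E \<B> s = (LEAST d. \<exists>a\<in>symbolic_exponents E \<B> s. monom_degree a = d)"

lemma symbolic_degree_le:
  "a \<in> symbolic_exponents E \<B> s \<Longrightarrow> symbolic_degree E \<B> s \<le> monom_degree a"
  unfolding symbolic_degree_def by (rule Least_le) blast

text \<open>
  The constant vector \<open>s\<close> satisfies all constraints, because transversals are nonempty.
\<close>

lemma symbolic_degree_attained:
  assumes "finite E" "\<B> \<noteq> {}"
  shows "\<exists>a\<in>symbolic_exponents E \<B> s. monom_degree a = symbolic_degree E \<B> s"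
proof -
  let ?a = "exponent_on E (\<lambda>_. s)"
  have "s \<le> deg_on C ?a" if C: "C \<in> minimal_transversals E \<B>" for C
  proof -
    have CE: "C \<subseteq> E" and "C \<noteq> {}"
      using C assms(2) by (auto simp: minimal_transversals_def transversal_def)
    then obtain e where "e \<in> C" by blast
    then have "Poly_Mapping.lookup ?a e \<le> deg_on C ?a"
      unfolding deg_on_def using finite_subset[OF CE assms(1)] by (intro member_le_sum) auto
    moreover have "Poly_Mapping.lookup ?a e = s"
      using \<open>e \<in> C\<close> CE assms(1) by (auto simp: lookup_exponent_on)
    ultimately show ?thesis by simp
  qed
  then have "?a \<in> symbolic_exponents E \<B> s"
    by (simp add: symbolic_exponents_def exponent_on_in_exponents assms)
  then have "\<exists>d. \<exists>a\<in>symbolic_exponents E \<B> s. monom_degree a = d" by blast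
  then show ?thesis unfolding symbolic_degree_def by (rule LeastI_ex)
qed

text \<open>
  Products of elements of the \<open>s\<close>-th and \<open>t\<close>-th symbolic powers lie in the \<open>(s + t)\<close>-th.
\<close>

lemma symbolic_degree_subadditive:
  assumes "finite E" "\<B> \<noteq> {}"
  shows "symbolic_degree E \<B> (s + t) \<le> symbolic_degree E \<B> s + symbolic_degree E \<B> t"
proof -
  obtain a b where a: "a \<in> symbolic_exponents E \<B> s" "monom_degree a = symbolic_degree E \<B> s"
    and b: "b \<in> symbolic_exponents E \<B> t" "monom_degree b = symbolic_degree E \<B> t"
    using symbolic_degree_attained[OF assms] by metis
  then have "a \<in> exponents E" "b \<in> exponents E" by (auto simp: symbolic_exponents_def)
  then have deg: "monom_degree (a + b) = monom_degree a + monom_degree b"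
    by (simp add: monom_degree_eq_deg_on[OF assms(1)] add_in_exponents deg_on_add)
  have "a + b \<in> symbolic_exponents E \<B> (s + t)"
    using a(1) b(1) by (auto simp: symbolic_exponents_def add_in_exponents deg_on_add intro: add_mono)
  then show ?thesis using symbolic_degree_le deg a b by metis
qed

section \<open>Facet ideals of graphic matroids\<close>

lemma basis_subset_edges: "B \<in> bases (graphic_matroid G) \<Longrightarrow> B \<subseteq> edges G"
  by (simp add: bases_graphic_matroid)

lemma finite_bases: "simple_graph G \<Longrightarrow> finite (bases (graphic_matroid G))"
  by (rule finite_subset[of _ "Pow (edges G)"]) (auto simp: finite_edges dest: basis_subset_edges)

text \<open>
  The exponents of the monomials in the facet ideal and in its symbolic powers; the latter are
  named after the graphic case, where the minimal transversals are the bonds.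
\<close>

abbreviation tree_exponents :: "'v graph \<Rightarrow> ('v set \<Rightarrow>\<^sub>0 nat) set" where
  "tree_exponents G \<equiv> exponents_above (edges G) (bases (graphic_matroid G))"

abbreviation cut_exponents :: "'v graph \<Rightarrow> nat \<Rightarrow> ('v set \<Rightarrow>\<^sub>0 nat) set" where
  "cut_exponents G \<equiv> symbolic_exponents (edges G) (bases (graphic_matroid G))"

lemma facet_ideal_graphic:
  assumes "simple_graph G"
  shows "facet_ideal (graphic_matroid G) = (monomial_ideal (tree_exponents G) :: ('v set, 'k::field) mpoly set)"
  using genideal_squarefree_monomials[OF finite_edges[OF assms] basis_subset_edges, of "bases (graphic_matroid G)"]
  by (simp add: facet_ideal_def graphic_matroid_def[of G] flip: bases_graphic_matroid)

lemma symbolic_power_facet_ideal: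
  assumes "simple_graph G"
  shows "symbolic_power (mpoly_ring (edges G)) (facet_ideal (graphic_matroid G)) s
           = (monomial_ideal (cut_exponents G s) :: ('v set, 'k::field) mpoly set)"
  unfolding facet_ideal_graphic[OF assms]
  by (rule symbolic_power_squarefree[OF finite_edges[OF assms] basis_subset_edges])

lemma asymptotic_resurgence_graphic:
  assumes "simple_graph G"
  shows "asymptotic_resurgence (edges G) (facet_ideal (graphic_matroid G) :: ('v set, 'k::field) mpoly set)
    = Sup {ereal (real s / real r) | s r. s > 0 \<and> r > 0 \<and>
       (\<forall>\<^sub>F t in sequentially.
          \<not> cut_exponents G (s * t) \<subseteq> nfold_sum (edges G) (tree_exponents G) (r * t))}"
  unfolding asymptotic_resurgence_def symbolic_power_facet_ideal[OF assms]
  unfolding facet_ideal_graphic[OF assms] ideal_power_monomial_ideal monomial_ideal_subset_iff ..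

lemma connected_has_basis:
  assumes "simple_graph G" "connected_graph G"
  shows "bases (graphic_matroid G) \<noteq> {}"
  using connecting_set_contains_basis[OF assms(1) order.refl] assms(2)
  by (auto simp: connected_graph_iff)

text \<open>
  The Waldschmidt constant is defined by \<open>lim\<close>, which is informative only for convergent sequences.
\<close>

lemma waldschmidt_constant_graphic:
  assumes "simple_graph G" "connected_graph G"
  shows "(\<lambda>s. real (symbolic_degree (edges G) (bases (graphic_matroid G)) s) / real s)
     \<longlonglongrightarrow> waldschmidt_constant (edges G) (facet_ideal (graphic_matroid G) :: ('v set, 'k::field) mpoly set)"
proof -
  have "convergent (\<lambda>s. real (symbolic_degree (edges G) (bases (graphic_matroid G)) s) / real s)"
    by (rule subadditive_ratio_convergent)
      (rule symbolic_degree_subadditive[OF finite_edges[OF assms(1)] connected_has_basis[OF assms]])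
  then show ?thesis
    unfolding waldschmidt_constant_def symbolic_power_facet_ideal[OF assms(1)]
      initial_degree_monomial_ideal symbolic_degree_def[symmetric]
    by (rule convergent_LIMSEQ_iff[THEN iffD1])
qed

section \<open>The upper bound\<close>

text \<open>
  \<open>card (e - {r})\<close> counts the orientations of \<open>e\<close> that do not point into \<open>r\<close>. The in-cuts of the
  bidirected graph are at least \<open>k\<close> because the edges between a nonempty proper vertex set and its
  complement form a transversal of the spanning trees.
\<close>

lemma rooted_basis_packing:
  assumes G: "simple_graph G" "connected_graph G" and r: "r \<in> verts G"
    and a: "a \<in> cut_exponents G k"
  shows "\<exists>B. (\<forall>i<k. B i \<in> bases (graphic_matroid G))
     \<and> (\<forall>e\<in>edges G. (\<Sum>i<k. of_bool (e \<in> B i)) \<le> Poly_Mapping.lookup a e * card (e - {r}))"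
proof -
  let ?V = "verts G" and ?E = "edges G"
  \<comment> \<open>Arcs into the root are useless for arborescences, and are given capacity zero.\<close>
  define c where "c p = (if snd p = r \<or> {fst p, snd p} \<notin> ?E then 0 else Poly_Mapping.lookup a {fst p, snd p})" for p
  have cut: "k \<le> in_cut c ?V S" if S: "S \<subseteq> ?V - {r}" "S \<noteq> {}" for S
  proof -
    define Q where "Q = {p \<in> (?V - S) \<times> S. {fst p, snd p} \<in> ?E}"
    let ?C = "(\<lambda>p. {fst p, snd p}) ` Q"
    have "transversal (bases (graphic_matroid G)) ?C"
      unfolding transversal_def
    proof
      fix B assume B: "B \<in> bases (graphic_matroid G)"
      obtain s where s: "s \<in> S" using S(2) by blast
      then have "(r, s) \<in> (adj B)\<^sup>*"
        using basis_connects[OF G(2) B] r S(1) by (auto simp: connects_def)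
      then obtain x y where xy: "{x, y} \<in> B" "x \<notin> S" "y \<in> S"
        using rtrancl_crosses[of r s "adj B" "- S"] s S(1) by (auto simp: adj_def)
      then have "{x, y} \<in> ?E" using basis_subset_edges[OF B] by blast
      moreover from this have "x \<in> ?V" using G(1) by (auto simp: simple_graph_def)
      ultimately have "(x, y) \<in> Q" using xy by (auto simp: Q_def)
      then have "{x, y} \<in> ?C" by force
      then show "B \<inter> ?C \<noteq> {}" using xy(1) by blast
    qed
    then have "k \<le> deg_on ?C a"
      by (intro deg_on_transversal_ge[OF finite_edges[OF G(1)] a]) (auto simp: Q_def)
    also have "deg_on ?C a = (\<Sum>p\<in>Q. Poly_Mapping.lookup a {fst p, snd p})"
      unfolding deg_on_def
      by (rule sum.reindex_cong[OF _ refl refl]) (auto simp: Q_def inj_on_def doubleton_eq_iff)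
    also have "\<dots> = sum c Q"
      using S(1) by (intro sum.cong) (auto simp: Q_def c_def)
    also have "\<dots> \<le> in_cut c ?V S"
      unfolding in_cut_def using G(1) S(1) finite_subset[of S ?V]
      by (intro sum_mono2) (auto simp: Q_def simple_graph_def)
    finally show ?thesis .
  qed
  have fin: "finite ?V" using G(1) by (simp add: simple_graph_def)
  obtain A where A: "\<forall>i<k. A i \<subseteq> ?V \<times> ?V \<and> (\<forall>v\<in>?V. (r, v) \<in> (A i)\<^sup>*)"
    and cap: "\<And>p. (\<Sum>i<k. of_bool (p \<in> A i)) \<le> c p"
    using arborescence_packing[OF fin r cut] by metis
  have "\<exists>B\<in>bases (graphic_matroid G). B \<subseteq> (\<lambda>p. {fst p, snd p}) ` A i" if i: "i < k" for i
  proof (rule connecting_set_contains_basis[OF G(1)])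
    show "(\<lambda>p. {fst p, snd p}) ` A i \<subseteq> ?E"
    proof
      fix e assume "e \<in> (\<lambda>p. {fst p, snd p}) ` A i"
      then obtain p where p: "p \<in> A i" "e = {fst p, snd p}" by blast
      have "of_bool (p \<in> A i) \<le> (\<Sum>i<k. of_bool (p \<in> A i) :: nat)"
        using i by (intro member_le_sum) auto
      with cap[of p] p(1) have "c p \<noteq> 0" by simp
      then show "e \<in> ?E" using p(2) by (auto simp: c_def split: if_splits)
    qed
    have "A i \<subseteq> adj ((\<lambda>p. {fst p, snd p}) ` A i)" by (force simp: adj_def)
    then have "(A i)\<^sup>* \<subseteq> (adj ((\<lambda>p. {fst p, snd p}) ` A i))\<^sup>*" by (rule rtrancl_mono)
    then have reach: "(r, v) \<in> (adj ((\<lambda>p. {fst p, snd p}) ` A i))\<^sup>*" if "v \<in> ?V" for v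
      using A i that by blast
    show "connects ((\<lambda>p. {fst p, snd p}) ` A i) ?V"
      unfolding connects_def
      using adj_rtrancl_sym[OF reach] reach by (blast intro: rtrancl_trans)
  qed
  then obtain B where B: "\<And>i. i < k \<Longrightarrow> B i \<in> bases (graphic_matroid G)"
    "\<And>i. i < k \<Longrightarrow> B i \<subseteq> (\<lambda>p. {fst p, snd p}) ` A i" by metis
  have "(\<Sum>i<k. of_bool (e \<in> B i)) \<le> Poly_Mapping.lookup a e * card (e - {r})" if e: "e \<in> ?E" for e
  proof -
    have "card e = 2" using e G(1) by (simp add: simple_graph_def)
    then obtain x y where xy: "e = {x, y}" "x \<noteq> y" by (auto simp: card_2_iff)
    have "of_bool (e \<in> B i) \<le> of_bool ((x, y) \<in> A i) + (of_bool ((y, x) \<in> A i) :: nat)" if "i < k" for i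
      using B(2)[OF that] xy by (force simp: doubleton_eq_iff)
    then have "(\<Sum>i<k. of_bool (e \<in> B i)) \<le> (\<Sum>i<k. of_bool ((x, y) \<in> A i) + (of_bool ((y, x) \<in> A i) :: nat))"
      by (intro sum_mono) simp
    also have "\<dots> \<le> c (x, y) + c (y, x)"
      unfolding sum.distrib using cap by (intro add_mono)
    also have "\<dots> = Poly_Mapping.lookup a e * card (e - {r})"
    proof (cases "r \<in> e")
      case True
      then have "card (e - {r}) = 1" using \<open>card e = 2\<close> by simp
      then show ?thesis using True xy e by (auto simp: c_def insert_commute)
    next
      case False
      then show ?thesis using \<open>card e = 2\<close> xy e by (auto simp: c_def insert_commute)
    qed
    finally show ?thesis .
  qed
  with B(1) show ?thesis by blast
qed

text \<open>
  The rooted packings for all roots together contain \<open>card (verts G) * k\<close> trees and load each edge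
  \<open>e\<close> at most \<open>D = 2 * (card (verts G) - 1)\<close> times its weight. Dividing the multiplicity of every tree by
  \<open>D\<close> and rounding down makes the packing fit and loses less than one tree for each basis.
\<close>

lemma symbolic_in_ordinary:
  assumes G: "simple_graph G" "connected_graph G" and n: "card (verts G) \<ge> 2"
    and a: "a \<in> cut_exponents G k"
    and k: "2 * (card (verts G) - 1) * (r + card (bases (graphic_matroid G))) \<le> card (verts G) * k"
  shows "a \<in> nfold_sum (edges G) (tree_exponents G) r"
proof -
  let ?V = "verts G" and ?E = "edges G" and ?\<B> = "bases (graphic_matroid G)"
  define D where "D = 2 * (card ?V - 1)"
  have D: "D > 0" using n by (simp add: D_def)
  have finV: "finite ?V" using G(1) by (simp add: simple_graph_def)
  note fin\<B> = finite_bases[OF G(1)]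
  obtain B where B: "\<And>v i. v \<in> ?V \<Longrightarrow> i < k \<Longrightarrow> B v i \<in> ?\<B>"
    and load: "\<And>v e. v \<in> ?V \<Longrightarrow> e \<in> ?E \<Longrightarrow>
        (\<Sum>i<k. of_bool (e \<in> B v i)) \<le> Poly_Mapping.lookup a e * card (e - {v})"
    using rooted_basis_packing[OF G _ a] by metis
  \<comment> \<open>\<open>N T\<close> is the multiplicity of the tree \<open>T\<close> in all rooted packings together.\<close>
  define N where "N T = (\<Sum>v\<in>?V. \<Sum>i<k. of_bool (B v i = T) :: nat)" for T
  have sum_N: "(\<Sum>T\<in>S. N T) = (\<Sum>v\<in>?V. \<Sum>i<k. of_bool (B v i \<in> S))" if "S \<subseteq> ?\<B>" for S
  proof -
    have finS: "finite S" using that fin\<B> finite_subset by blast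
    have "(\<Sum>T\<in>S. N T) = (\<Sum>v\<in>?V. \<Sum>i<k. \<Sum>T\<in>S. of_bool (B v i = T))"
      unfolding N_def by (subst sum.swap) (intro sum.cong refl, rule sum.swap)
    also have "\<dots> = (\<Sum>v\<in>?V. \<Sum>i<k. of_bool (B v i \<in> S))"
      using finS by (intro sum.cong refl) (simp add: of_bool_def)
    finally show ?thesis .
  qed
  have total: "(\<Sum>T\<in>?\<B>. N T) = card ?V * k"
    using B by (simp add: sum_N)
  have edge_load: "(\<Sum>T\<in>{T \<in> ?\<B>. e \<in> T}. N T) \<le> Poly_Mapping.lookup a e * D" if e: "e \<in> ?E" for e
  proof -
    have e2: "card e = 2" "e \<subseteq> ?V" using e G(1) by (auto simp: simple_graph_def)
    then have fine: "finite e" using finV finite_subset by blast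
    have "(\<Sum>T\<in>{T \<in> ?\<B>. e \<in> T}. N T) = (\<Sum>v\<in>?V. \<Sum>i<k. of_bool (B v i \<in> {T \<in> ?\<B>. e \<in> T}))"
      by (rule sum_N) auto
    also have "\<dots> = (\<Sum>v\<in>?V. \<Sum>i<k. of_bool (e \<in> B v i))"
      using B by (intro sum.cong refl) auto
    also have "\<dots> \<le> (\<Sum>v\<in>?V. Poly_Mapping.lookup a e * card (e - {v}))"
      using load e by (intro sum_mono)
    also have "\<dots> = Poly_Mapping.lookup a e * (\<Sum>v\<in>?V. card (e - {v}))"
      by (simp add: sum_distrib_left)
    also have "(\<Sum>v\<in>?V. card (e - {v})) = (\<Sum>v\<in>?V. \<Sum>x\<in>e. of_bool (x \<noteq> v))"
      using fine by (intro sum.cong refl) (simp add: Int_def set_diff_eq)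
    also have "\<dots> = (\<Sum>x\<in>e. \<Sum>v\<in>?V. of_bool (x \<noteq> v))" by (rule sum.swap)
    also have "\<dots> = (\<Sum>x\<in>e. card ?V - 1)"
    proof (intro sum.cong refl)
      fix x assume "x \<in> e"
      have "(\<Sum>v\<in>?V. of_bool (x \<noteq> v)) = card (?V - {x})"
        using finV by (simp add: Int_def set_diff_eq eq_commute)
      also have "\<dots> = card ?V - 1" using \<open>x \<in> e\<close> e2 finV by (intro card_Diff_singleton) auto
      finally show "(\<Sum>v\<in>?V. of_bool (x \<noteq> v)) = card ?V - 1" .
    qed
    also have "\<dots> = D" using e2 by (simp add: D_def)
    finally show ?thesis .
  qed
  show ?thesis
  proof (rule nfold_sum_above_if_packing[OF finite_edges[OF G(1)] fin\<B> basis_subset_edges])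
    show "a \<in> exponents ?E" using a by (simp add: symbolic_exponents_def)
    have "card ?V * k \<le> (\<Sum>T\<in>?\<B>. D * (N T div D) + D)"
      unfolding total[symmetric]
    proof (rule sum_mono)
      fix T
      show "N T \<le> D * (N T div D) + D"
        using dividend_less_div_times[OF D, of "N T"] by (simp add: mult.commute)
    qed
    also have "\<dots> = D * ((\<Sum>T\<in>?\<B>. N T div D) + card ?\<B>)"
      by (simp add: sum.distrib sum_distrib_left distrib_left)
    finally have "D * (r + card ?\<B>) \<le> D * ((\<Sum>T\<in>?\<B>. N T div D) + card ?\<B>)"
      using k unfolding D_def by linarith
    then show "r \<le> (\<Sum>T\<in>?\<B>. N T div D)" using D by simp
  next
    fix e assume e: "e \<in> ?E"
    have "D * (\<Sum>T\<in>{T \<in> ?\<B>. e \<in> T}. N T div D) \<le> (\<Sum>T\<in>{T \<in> ?\<B>. e \<in> T}. N T)"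
      unfolding sum_distrib_left by (intro sum_mono) simp
    also have "\<dots> \<le> D * Poly_Mapping.lookup a e"
      using edge_load[OF e] by (simp add: mult.commute)
    finally show "(\<Sum>T\<in>{T \<in> ?\<B>. e \<in> T}. N T div D) \<le> Poly_Mapping.lookup a e"
      using D by simp
  qed
qed

lemma asymptotic_resurgence_le:
  assumes G: "simple_graph G" "connected_graph G" and n: "card (verts G) \<ge> 2"
  shows "asymptotic_resurgence (edges G) (facet_ideal (graphic_matroid G) :: ('v set, 'k::field) mpoly set)
           \<le> ereal (2 - 2 / real (card (verts G)))"
  unfolding asymptotic_resurgence_graphic[OF G(1)]
proof (rule Sup_least, clarify)
  let ?n = "card (verts G)" and ?b = "card (bases (graphic_matroid G))"
  let ?D = "2 * (?n - 1)"
  fix s r :: nat assume sr: "s > 0" "r > 0"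
    and ev: "\<forall>\<^sub>F t in sequentially.
          \<not> cut_exponents G (s * t) \<subseteq> nfold_sum (edges G) (tree_exponents G) (r * t)"
  show "ereal (real s / real r) \<le> ereal (2 - 2 / real ?n)"
  proof (rule ccontr)
    assume "\<not> ?thesis"
    then have "2 - 2 / real ?n < real s / real r" by simp
    then have "(2 * real ?n - 2) * real r < real ?n * real s"
      using sr n by (simp add: field_simps)
    also have "2 * real ?n - 2 = real ?D" using n by (simp add: of_nat_diff)
    finally have "real (?D * r) < real (?n * s)" by simp
    then have less: "Suc (?D * r) \<le> ?n * s" by (simp only: of_nat_less_iff Suc_le_eq)
    obtain t0 where t0: "\<And>t. t \<ge> t0 \<Longrightarrow>
        \<not> cut_exponents G (s * t) \<subseteq> nfold_sum (edges G) (tree_exponents G) (r * t)"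
      using ev unfolding eventually_sequentially by blast
    \<comment> \<open>The strict inequality between \<open>?D * r\<close> and \<open>?n * s\<close> is worth \<open>t\<close> after scaling by \<open>t\<close>,
      which pays for the rounding error \<open>?D * ?b\<close>.\<close>
    define t where "t = max t0 (?D * ?b)"
    have "Suc (?D * r) * t \<le> ?n * s * t" using less by (rule mult_right_mono) simp
    moreover have "?D * ?b \<le> t" by (simp add: t_def)
    ultimately have "?D * (r * t + ?b) \<le> ?n * (s * t)" by (simp add: algebra_simps)
    then have "cut_exponents G (s * t) \<subseteq> nfold_sum (edges G) (tree_exponents G) (r * t)"
      using symbolic_in_ordinary[OF G n] by blast
    with t0[of t] show False by (simp add: t_def)
  qed
qed

section \<open>The lower bound\<close>

text \<open>
  Contract the blocks of a retraction of \<open>G\<close> onto the vertices of \<open>H\<close>. The extended exponent is \<open>k\<close>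
  on the edges inside blocks (\<open>?L\<close>) and agrees with \<open>b\<close> on the edges between blocks (\<open>?D\<close>). A
  transversal of the bases of \<open>G\<close> either contains an edge inside a block or restricts to a
  transversal of the bases of \<open>H\<close>, since a spanning tree of \<open>H\<close> connects \<open>G\<close> together with \<open>?L\<close>.
  Every spanning tree of \<open>G\<close> contains \<open>card (verts H) - 1\<close> edges of \<open>?D\<close>, so \<open>b\<close> is too small for
  \<open>r\<close> of them.
\<close>

lemma extend_exponent_to_supergraph:
  assumes G: "simple_graph G" "connected_graph G" and H: "simple_graph H" "connected_graph H"
    and sub: "subgraph H G"
    and b: "b \<in> cut_exponents H k" and small: "deg_on (edges H) b < r * (card (verts H) - 1)"
  shows "\<exists>a\<in>cut_exponents G k. a \<notin> nfold_sum (edges G) (tree_exponents G) r"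
proof -
  let ?V = "verts G" and ?E = "edges G" and ?U = "verts H"
  have U: "?U \<subseteq> ?V" "?U \<noteq> {}" and EH: "edges H \<subseteq> ?E"
    using sub H(2) by (auto simp: subgraph_def connected_graph_def)
  have finE: "finite ?E" by (rule finite_edges[OF G(1)])
  obtain \<phi> where \<phi>: "\<forall>u\<in>?U. \<phi> u = u" "\<phi> ` ?V \<subseteq> ?U"
    and blocks: "\<forall>v\<in>?V. (v, \<phi> v) \<in> (adj {e \<in> ?E. card (\<phi> ` e) = 1})\<^sup>*"
    using connected_retraction[OF G U] by blast
  let ?L = "{e \<in> ?E. card (\<phi> ` e) = 1}" and ?D = "{e \<in> ?E. card (\<phi> ` e) = 2}"
  have b_zero: "Poly_Mapping.lookup b e = 0" if "e \<notin> edges H" for e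
    using b that by (auto simp: symbolic_exponents_def exponents_def in_keys_iff subset_iff)
  define a where "a = exponent_on ?E (\<lambda>e. if card (\<phi> ` e) = 1 then k else Poly_Mapping.lookup b e)"
  have a: "Poly_Mapping.lookup a e = (if card (\<phi> ` e) = 1 then k else Poly_Mapping.lookup b e)"
    if "e \<in> ?E" for e
    using that finE by (simp add: a_def lookup_exponent_on)
  have "k \<le> deg_on C a" if C: "C \<in> minimal_transversals ?E (bases (graphic_matroid G))" for C
  proof -
    have CE: "C \<subseteq> ?E" and tr: "transversal (bases (graphic_matroid G)) C"
      using C by (auto simp: minimal_transversals_def)
    have finC: "finite C" using CE finE finite_subset by blast
    show ?thesis
    proof (cases "C \<inter> ?L = {}")
      case False
      then obtain e where e: "e \<in> C" "e \<in> ?L" by blast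
      then have "Poly_Mapping.lookup a e = k" using a by auto
      moreover have "Poly_Mapping.lookup a e \<le> deg_on C a"
        unfolding deg_on_def using e(1) finC by (intro member_le_sum) auto
      ultimately show ?thesis by simp
    next
      case True
      have "transversal (bases (graphic_matroid H)) (C \<inter> edges H)"
        unfolding transversal_def
      proof
        fix B assume B: "B \<in> bases (graphic_matroid H)"
        have BH: "B \<subseteq> edges H" by (rule basis_subset_edges[OF B])
        have mono: "(adj B)\<^sup>* \<subseteq> (adj (B \<union> ?L))\<^sup>*" "(adj ?L)\<^sup>* \<subseteq> (adj (B \<union> ?L))\<^sup>*"
          by (intro rtrancl_mono; auto simp: adj_def)+
        have "connects (B \<union> ?L) ?V"
          unfolding connects_def
        proof (intro ballI)
          fix u v assume uv: "u \<in> ?V" "v \<in> ?V"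
          have "(u, \<phi> u) \<in> (adj (B \<union> ?L))\<^sup>*" "(v, \<phi> v) \<in> (adj (B \<union> ?L))\<^sup>*"
            using blocks uv mono(2) by blast+
          moreover have "(\<phi> u, \<phi> v) \<in> (adj (B \<union> ?L))\<^sup>*"
            using basis_connects[OF H(2) B] \<phi>(2) uv mono(1) unfolding connects_def by blast
          ultimately show "(u, v) \<in> (adj (B \<union> ?L))\<^sup>*"
            using adj_rtrancl_sym[of v "\<phi> v"] by (meson rtrancl_trans)
        qed
        moreover have "B \<union> ?L \<subseteq> ?E" using BH EH by blast
        ultimately obtain T where T: "T \<in> bases (graphic_matroid G)" "T \<subseteq> B \<union> ?L"
          using connecting_set_contains_basis[OF G(1)] by blast
        then have "T \<inter> C \<noteq> {}" using tr by (auto simp: transversal_def)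
        then show "B \<inter> (C \<inter> edges H) \<noteq> {}" using T(2) True BH by blast
      qed
      then have "k \<le> deg_on (C \<inter> edges H) b"
        by (intro deg_on_transversal_ge[OF finite_edges[OF H(1)] b]) auto
      also have "\<dots> = deg_on (C \<inter> edges H) a"
        unfolding deg_on_def
      proof (rule sum.cong[OF refl])
        fix e assume "e \<in> C \<inter> edges H"
        then have "e \<in> ?E" "card (\<phi> ` e) \<noteq> 1" using True CE by blast+
        then show "Poly_Mapping.lookup b e = Poly_Mapping.lookup a e" by (simp add: a)
      qed
      also have "\<dots> \<le> deg_on C a" by (rule deg_on_mono[OF finC]) auto
      finally show ?thesis .
    qed
  qed
  then have "a \<in> cut_exponents G k"
    unfolding symbolic_exponents_def a_def by (simp add: exponent_on_in_exponents finE)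
  moreover have "a \<notin> nfold_sum ?E (tree_exponents G) r"
  proof
    assume mem: "a \<in> nfold_sum ?E (tree_exponents G) r"
    have tree: "card ?U - 1 \<le> deg_on ?D x" if "x \<in> tree_exponents G" for x
    proof -
      obtain B where B: "B \<in> bases (graphic_matroid G)" "B \<subseteq> Poly_Mapping.keys x"
        using \<open>x \<in> tree_exponents G\<close> by (auto simp: exponents_above_def)
      note BE = basis_subset_edges[OF B(1)]
      have "card ?U \<le> Suc (card {e \<in> B. card (\<phi> ` e) = 2})"
      proof (rule card_quotient_le_crossing_edges)
        show "connects B ?V" by (rule basis_connects[OF G(2) B(1)])
        show "?V \<noteq> {}" using U by blast
        show "finite B" using BE finE finite_subset by blast
        show "finite ?U" using H(1) by (simp add: simple_graph_def)
        show "\<phi> ` ?V = ?U" using \<phi> U(1) by force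
        show "e \<subseteq> ?V" if "e \<in> B" for e using that BE G(1) by (auto simp: simple_graph_def)
      qed
      moreover have "card {e \<in> B. card (\<phi> ` e) = 2} \<le> deg_on ?D x"
      proof -
        have "card {e \<in> B. card (\<phi> ` e) = 2} = (\<Sum>e\<in>{e \<in> B. card (\<phi> ` e) = 2}. 1)" by simp
        also have "\<dots> \<le> deg_on {e \<in> B. card (\<phi> ` e) = 2} x"
          unfolding deg_on_def using B(2) by (intro sum_mono) (auto simp: in_keys_iff Suc_le_eq subset_iff)
        also have "\<dots> \<le> deg_on ?D x" using BE finE by (intro deg_on_mono) auto
        finally show ?thesis .
      qed
      ultimately show ?thesis by linarith
    qed
    have "r * (card ?U - 1) \<le> deg_on ?D a" by (rule deg_on_nfold_sum_ge[OF tree mem])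
    also have "\<dots> = deg_on ?D b" unfolding deg_on_def using a by (intro sum.cong) auto
    also have "\<dots> \<le> deg_on ?E b" using finE by (intro deg_on_mono) auto
    also have "\<dots> = deg_on (edges H) b"
      unfolding deg_on_def using finE EH b_zero by (intro sum.mono_neutral_right) auto
    finally show False using small by simp
  qed
  ultimately show ?thesis by blast
qed

text \<open>
  Every rational \<open>s / r\<close> below the bound belongs to the set whose supremum is the asymptotic
  resurgence: \<open>s / r < 2 (m - 1) / m\<close> means \<open>s m / 2 < r (m - 1)\<close>,
  and the least degree of the symbolic power of exponent \<open>s t\<close> for \<open>H\<close> is about \<open>s t m / 2\<close>, hence less than
  \<open>r t (m - 1)\<close> for large \<open>t\<close>.
\<close>

lemma asymptotic_resurgence_ge:
  assumes G: "simple_graph G" "connected_graph G" and H: "simple_graph H" "connected_graph H"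
    and sub: "subgraph H G" and m: "card (verts H) = m" "m \<ge> 2"
    and w: "waldschmidt_constant (edges H)
       (facet_ideal (graphic_matroid H) :: ('v set, 'k::field) mpoly set) = real m / 2"
  shows "ereal (2 - 2 / real m)
     \<le> asymptotic_resurgence (edges G) (facet_ideal (graphic_matroid G) :: ('v set, 'k) mpoly set)"
    (is "_ \<le> ?\<rho>")
proof -
  let ?\<B> = "bases (graphic_matroid H)"
  let ?\<alpha> = "symbolic_degree (edges H) ?\<B>"
  note finE = finite_edges[OF H(1)]
  have lim: "(\<lambda>s. real (?\<alpha> s) / real s) \<longlonglongrightarrow> real m / 2"
    using waldschmidt_constant_graphic[OF H, where ?'k = 'k] w by simp
  have ratio: "ereal (real s / real r) \<le> ?\<rho>"
    if sr: "s > 0" "r > 0" "real s / real r < 2 - 2 / real m" for s r :: nat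
  proof -
    have "real s / real r * (real r * real m) < (2 - 2 / real m) * (real r * real m)"
      using sr m by (intro mult_strict_right_mono) auto
    then have "real s * real m < 2 * real r * (real m - 1)"
      using sr m by (simp add: field_simps)
    then have "real m / 2 < real r * (real m - 1) / real s"
      using sr by (simp add: field_simps)
    then have "\<forall>\<^sub>F j in sequentially. real (?\<alpha> j) / real j < real r * (real m - 1) / real s"
      by (rule order_tendstoD(2)[OF lim])
    then obtain j0 where j0: "\<And>j. j \<ge> j0 \<Longrightarrow> real (?\<alpha> j) / real j < real r * (real m - 1) / real s"
      unfolding eventually_sequentially by blast
    have "\<not> cut_exponents G (s * t) \<subseteq> nfold_sum (edges G) (tree_exponents G) (r * t)"
      if t: "t \<ge> max 1 j0" for t
    proof -
      have "t \<le> s * t" using sr(1) by simp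
      then have "real (?\<alpha> (s * t)) / real (s * t) < real r * (real m - 1) / real s"
        using t by (intro j0) linarith
      then have "real (?\<alpha> (s * t)) < real r * (real m - 1) / real s * real (s * t)"
        using t sr(1) by (simp add: pos_divide_less_eq)
      also have "\<dots> = real (r * t * (m - 1))"
        using sr(1) m(2) by (simp add: of_nat_diff)
      finally have "?\<alpha> (s * t) < r * t * (m - 1)" by (simp only: of_nat_less_iff)
      moreover obtain b where b: "b \<in> cut_exponents H (s * t)" "monom_degree b = ?\<alpha> (s * t)"
        using symbolic_degree_attained[OF finE connected_has_basis[OF H]] by blast
      moreover have "monom_degree b = deg_on (edges H) b"
        using b(1) by (intro monom_degree_eq_deg_on[OF finE]) (simp add: symbolic_exponents_def)
      ultimately show ?thesis
        using extend_exponent_to_supergraph[OF G H sub b(1), of "r * t"] m(1) by auto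
    qed
    then have "\<forall>\<^sub>F t in sequentially.
        \<not> cut_exponents G (s * t) \<subseteq> nfold_sum (edges G) (tree_exponents G) (r * t)"
      unfolding eventually_sequentially by blast
    then show ?thesis
      unfolding asymptotic_resurgence_graphic[OF G(1)] using sr by (intro Sup_upper) blast
  qed
  show ?thesis
  proof (rule ccontr)
    assume "\<not> ?thesis"
    then obtain z where z: "?\<rho> < ereal z" "ereal z < ereal (2 - 2 / real m)"
      using ereal_dense2[of ?\<rho> "ereal (2 - 2 / real m)"] by (auto simp: not_le)
    have "0 < 2 - 2 / real m" using m(2) by (simp add: field_simps)
    then have "max z 0 < 2 - 2 / real m" using z(2) by simp
    then obtain q where q: "q \<in> \<rat>" "max z 0 < q" "q < 2 - 2 / real m"
      using Rats_dense_in_real by blast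
    obtain s r :: nat where sr: "r \<noteq> 0" "\<bar>q\<bar> = real s / real r"
      using Rats_abs_nat_div_natE[OF q(1)] by metis
    then have "q = real s / real r" using q(2) by simp
    moreover from this q(2) sr(1) have "s > 0" by (cases s) auto
    ultimately have "ereal q \<le> ?\<rho>" using ratio[of s r] q sr(1) by simp
    moreover have "ereal z \<le> ereal q" using q(2) by simp
    ultimately show False using z(1) by (meson leD order_trans)
  qed
qed

lemma two_connected_imp_connected: "two_connected G \<Longrightarrow> connected_graph G"
  by (simp add: two_connected_def)

lemma two_connected_card_ge_2:
  assumes "simple_graph G" "two_connected G"
  shows "card (verts G) \<ge> 2"
proof -
  obtain v where v: "v \<in> verts G" using assms(2) by (auto simp: two_connected_def connected_graph_def)
  then have "connected_graph (delete_vertex G v)" using assms(2) by (simp add: two_connected_def)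
  then obtain u where "u \<in> verts G" "u \<noteq> v" by (auto simp: connected_graph_def delete_vertex_def)
  then have "card {u, v} \<le> card (verts G)"
    using v assms(1) by (intro card_mono) (auto simp: simple_graph_def)
  then show ?thesis using \<open>u \<noteq> v\<close> by simp
qed

theorem corollary5p7:
  fixes G H :: "'v graph" and m :: nat
  assumes "simple_graph G" and "two_connected G"
    and "rank (graphic_matroid G) < card (edges G)"
    and "simple_graph H" and "two_connected H"
    and "rank (graphic_matroid H) < card (edges H)"
    and "subgraph H G" and "card (verts H) = m"
    and "waldschmidt_constant (edges H)
           (facet_ideal (graphic_matroid H) :: ('v set, 'k::field) mpoly set) = real m / 2"
  shows "asymptotic_resurgence (edges G)
           (facet_ideal (graphic_matroid G) :: ('v set, 'k) mpoly set)
           \<ge> ereal (2 - 2 / real m)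
       \<and> (spanning H G \<longrightarrow>
         asymptotic_resurgence (edges G)
           (facet_ideal (graphic_matroid G) :: ('v set, 'k) mpoly set)
           = ereal (2 - 2 / real (card (verts G))))"
proof -
  have G: "connected_graph G" and H: "connected_graph H"
    using assms two_connected_imp_connected by blast+
  have "m \<ge> 2" using two_connected_card_ge_2[OF assms(4,5)] assms(8) by simp
  then have lower: "ereal (2 - 2 / real m)
     \<le> asymptotic_resurgence (edges G) (facet_ideal (graphic_matroid G) :: ('v set, 'k) mpoly set)"
    by (intro asymptotic_resurgence_ge[OF assms(1) G assms(4) H assms(7,8) _ assms(9)])
  moreover have "asymptotic_resurgence (edges G) (facet_ideal (graphic_matroid G) :: ('v set, 'k) mpoly set)
     = ereal (2 - 2 / real (card (verts G)))" if "spanning H G"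
  proof (rule antisym)
    show "asymptotic_resurgence (edges G) (facet_ideal (graphic_matroid G) :: ('v set, 'k) mpoly set)
       \<le> ereal (2 - 2 / real (card (verts G)))"
      by (rule asymptotic_resurgence_le[OF assms(1) G two_connected_card_ge_2[OF assms(1,2)]])
    show "ereal (2 - 2 / real (card (verts G)))
       \<le> asymptotic_resurgence (edges G) (facet_ideal (graphic_matroid G) :: ('v set, 'k) mpoly set)"
      using lower that assms(8) by (simp add: spanning_def)
  qed
  ultimately show ?thesis by blast
qed

end
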